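(* Let $\mathcal{C}=(\mathcal{C}_N)_{N\ge 1}$ be an arbitrary (uniform family of) poly-sized Clifford circuit(s), where $\mathcal{C}_N$ acts on $N$ qubits. Then there exists a (uniform family of) poly-sized Clifford circuit(s) $\mathcal{C}'=(\mathcal{C}'_N)_{N\ge 1}$ such that for every $N$, up to a global phase factor (a complex number of modulus one), $$\mathcal{C}_N|0\rangle^{\otimes N} = \mathcal{C}'_N|0\rangle^{\otimes N},$$ and such that each $\mathcal{C}'_N$ can be decomposed into three consecutive rounds: (ROUND 1) Hadamard gates are applied to some subset of the qubits; (ROUND 2) a poly-sized circuit consisting of NOT and CNOT gates is applied; (ROUND 3) a poly-sized circuit consisting of PHASE and CPHASE gates is applied. Moreover, the circuit $\mathcal{C}'$ can be efficiently determined: there is a classical polynomial-time algorithm which, given the description of $\mathcal{C}_N$ as a list of gates, outputs a description of $\mathcal{C}'_N$ together with its decomposition into the three rounds.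
   Context: Gates: Hadamard $H=\frac{1}{\sqrt2}\begin{pmatrix}1&1\\1&-1\end{pmatrix}$; PHASE $P=\mathrm{diag}(1,i)$, i.e. $P|a\rangle=i^a|a\rangle$; NOT $X|a\rangle=|a\oplus 1\rangle$; CNOT $|a,b\rangle\mapsto|a,a\oplus b\rangle$; CPHASE $|a,b\rangle\mapsto(-1)^{ab}|a,b\rangle$, for $a,b\in\{0,1\}$. Two-qubit gates may act on any ordered pair of distinct qubits. A Clifford circuit is a quantum circuit composed of Hadamard, PHASE and CNOT gates (NOT and CPHASE gates are compositions of these, so they are also allowed in Clifford circuits). "Poly-sized" means that the number of gates is bounded by a polynomial in the number $N$ of qubits. A uniform family of circuits is one for which a description of the $N$-th circuit can be generated by a classical computer in time polynomial in $N$. Any of the rounds may be empty. *)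

theory Defs
  imports "Jordan_Normal_Form.Matrix" "HOL-Computational_Algebra.Polynomial"
begin

section \<open>Circuits\<close>

datatype gate =
    is_HAD: HAD nat
  | is_PHASE: PHASE nat
  | is_NOT: NOT nat
  | is_CNOT: CNOT nat nat
  | is_CPHASE: CPHASE nat nat

fun gate_on :: "nat \<Rightarrow> gate \<Rightarrow> bool" where
  "gate_on N (HAD q) \<longleftrightarrow> q < N"
| "gate_on N (PHASE q) \<longleftrightarrow> q < N"
| "gate_on N (NOT q) \<longleftrightarrow> q < N"
| "gate_on N (CNOT a b) \<longleftrightarrow> a < N \<and> b < N \<and> a \<noteq> b"
| "gate_on N (CPHASE a b) \<longleftrightarrow> a < N \<and> b < N \<and> a \<noteq> b"

text \<open>\<open>NOT\<close> and \<open>CPHASE\<close> are compositions of the other three gates. Gates are listed in the order in which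
  they are applied.\<close>

definition clifford_circuit :: "nat \<Rightarrow> gate list \<Rightarrow> bool" where
  "clifford_circuit N gs \<longleftrightarrow> (\<forall>g\<in>set gs. gate_on N g)"

text \<open>The computational basis state \<open>|x\<^sub>0, \<dots>, x\<^bsub>N-1\<^esub>\<rangle>\<close> has index \<open>\<Sum>k<N. x\<^sub>k * 2 ^ k\<close>, so that
  \<open>bit j k\<close> is the value of qubit \<open>k\<close> in the basis state with index \<open>j\<close>.\<close>

definition hadamard :: "complex mat" where
  "hadamard = complex_of_real (1 / sqrt 2) \<cdot>\<^sub>m mat_of_rows_list 2 [[1, 1], [1, -1]]"

fun gate_entry :: "gate \<Rightarrow> nat \<Rightarrow> nat \<Rightarrow> complex" where
  "gate_entry (HAD q) i j =
     (if unset_bit q i = unset_bit q j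
      then hadamard $$ (of_bool (bit i q), of_bool (bit j q)) else 0)"
| "gate_entry (PHASE q) i j = (if i = j then \<i> ^ of_bool (bit j q) else 0)"
| "gate_entry (NOT q) i j = (if i = flip_bit q j then 1 else 0)"
| "gate_entry (CNOT a b) i j = (if i = (if bit j a then flip_bit b j else j) then 1 else 0)"
| "gate_entry (CPHASE a b) i j =
     (if i = j then (-1) ^ (of_bool (bit j a) * of_bool (bit j b)) else 0)"

definition gate_mat :: "nat \<Rightarrow> gate \<Rightarrow> complex mat" where
  "gate_mat N g = mat (2 ^ N) (2 ^ N) (\<lambda>(i, j). gate_entry g i j)"

definition apply_circuit :: "nat \<Rightarrow> gate list \<Rightarrow> complex vec \<Rightarrow> complex vec" where
  "apply_circuit N gs v = fold (\<lambda>g v. gate_mat N g *\<^sub>v v) gs v"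

definition zero_state :: "nat \<Rightarrow> complex vec" where
  "zero_state N = unit_vec (2 ^ N) 0"

definition equal_up_to_phase :: "complex vec \<Rightarrow> complex vec \<Rightarrow> bool" where
  "equal_up_to_phase v w \<longleftrightarrow> (\<exists>c. cmod c = 1 \<and> v = c \<cdot>\<^sub>v w)"

definition hadamard_round :: "nat \<Rightarrow> gate list \<Rightarrow> bool" where
  "hadamard_round N gs \<longleftrightarrow> (\<exists>qs. distinct qs \<and> set qs \<subseteq> {..<N} \<and> gs = map HAD qs)"

definition not_cnot_round :: "nat \<Rightarrow> gate list \<Rightarrow> bool" where
  "not_cnot_round N gs \<longleftrightarrow> clifford_circuit N gs \<and> (\<forall>g\<in>set gs. is_NOT g \<or> is_CNOT g)"

definition phase_cphase_round :: "nat \<Rightarrow> gate list \<Rightarrow> bool" where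
  "phase_cphase_round N gs \<longleftrightarrow> clifford_circuit N gs \<and> (\<forall>g\<in>set gs. is_PHASE g \<or> is_CPHASE g)"

text \<open>Circuit families are indexed by \<open>N \<ge> 1\<close>; their value at \<open>0\<close> is irrelevant.\<close>

definition clifford_family :: "(nat \<Rightarrow> gate list) \<Rightarrow> bool" where
  "clifford_family C \<longleftrightarrow> (\<forall>N\<ge>1. clifford_circuit N (C N))"

definition poly_sized :: "(nat \<Rightarrow> gate list) \<Rightarrow> bool" where
  "poly_sized C \<longleftrightarrow> (\<exists>p :: nat poly. \<forall>N\<ge>1. length (C N) \<le> poly p N)"

section \<open>Classical computation\<close>

text \<open>The machine model is the WHILE language over binary trees (N. D. Jones, Computability and
  Complexity from a Programming Perspective, 1997). Reading a variable is charged with the size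
  of the tree it contains, as if the tree were copied. A program running in time \<open>t\<close> therefore
  only ever builds trees of size at most \<open>t\<close> plus that of the input, and the model simulates, and
  is simulated by, Turing machines with polynomial overhead.\<close>

datatype tree = Leaf | Node tree tree

fun left :: "tree \<Rightarrow> tree" where
  "left Leaf = Leaf"
| "left (Node a b) = a"

fun right :: "tree \<Rightarrow> tree" where
  "right Leaf = Leaf"
| "right (Node a b) = b"

type_synonym store = "nat \<Rightarrow> tree"

datatype exp = Var nat | LeafE | NodeE exp exp | LeftE exp | RightE exp

fun eval_exp :: "exp \<Rightarrow> store \<Rightarrow> tree" where
  "eval_exp (Var x) s = s x"
| "eval_exp LeafE s = Leaf"
| "eval_exp (NodeE a b) s = Node (eval_exp a s) (eval_exp b s)"
| "eval_exp (LeftE a) s = left (eval_exp a s)"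
| "eval_exp (RightE a) s = right (eval_exp a s)"

fun cost :: "exp \<Rightarrow> store \<Rightarrow> nat" where
  "cost (Var x) s = 1 + size (s x)"
| "cost LeafE s = 1"
| "cost (NodeE a b) s = 1 + cost a s + cost b s"
| "cost (LeftE a) s = 1 + cost a s"
| "cost (RightE a) s = 1 + cost a s"

datatype com = Skip | Assign nat exp | Seq com com | If exp com com | While exp com

text \<open>\<open>exec c s t s'\<close>: started in store \<open>s\<close>, program \<open>c\<close> terminates in store \<open>s'\<close> after time \<open>t\<close>.
  In tests, \<open>Leaf\<close> means false and every other tree means true.\<close>

inductive exec :: "com \<Rightarrow> store \<Rightarrow> nat \<Rightarrow> store \<Rightarrow> bool" where
  exec_Skip: "exec Skip s 1 s"
| exec_Assign: "exec (Assign x e) s (1 + cost e s) (s(x := eval_exp e s))"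
| exec_Seq: "exec c s t s' \<Longrightarrow> exec d s' t' s'' \<Longrightarrow> exec (Seq c d) s (t + t') s''"
| exec_IfTrue: "eval_exp e s \<noteq> Leaf \<Longrightarrow> exec c s t s' \<Longrightarrow> exec (If e c d) s (1 + cost e s + t) s'"
| exec_IfFalse: "eval_exp e s = Leaf \<Longrightarrow> exec d s t s' \<Longrightarrow> exec (If e c d) s (1 + cost e s + t) s'"
| exec_WhileFalse: "eval_exp e s = Leaf \<Longrightarrow> exec (While e c) s (1 + cost e s) s"
| exec_WhileTrue: "eval_exp e s \<noteq> Leaf \<Longrightarrow> exec c s t s' \<Longrightarrow> exec (While e c) s' t' s'' \<Longrightarrow>
    exec (While e c) s (1 + cost e s + t + t') s''"

lemma exec_deterministic:
  "exec c s t s' \<Longrightarrow> exec c s u r \<Longrightarrow> u = t \<and> r = s'"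
proof (induction arbitrary: u r rule: exec.induct)
  case (exec_WhileTrue e s c t s' t' s'')
  from exec_WhileTrue.prems obtain t1 s1 t2 where
    "exec c s t1 s1" "exec (While e c) s1 t2 r" "u = 1 + cost e s + t1 + t2"
    by cases (use exec_WhileTrue.hyps(1) in auto)
  with exec_WhileTrue.IH show ?case by metis
next
  case (exec_Seq c s t s' d t' s'')
  from exec_Seq.prems obtain t1 s1 t2 where
    "exec c s t1 s1" "exec d s1 t2 r" "u = t1 + t2"
    by cases auto
  with exec_Seq.IH show ?case by metis
next
  case (exec_IfTrue e s c t s' d)
  from exec_IfTrue.prems obtain t1 where "exec c s t1 r" "u = 1 + cost e s + t1"
    by cases (use exec_IfTrue.hyps(1) in auto)
  with exec_IfTrue.IH show ?case by metis
next
  case (exec_IfFalse e s d t s' c)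
  from exec_IfFalse.prems obtain t1 where "exec d s t1 r" "u = 1 + cost e s + t1"
    by cases (use exec_IfFalse.hyps(1) in auto)
  with exec_IfFalse.IH show ?case by metis
next
  case (exec_WhileFalse e s c)
  from exec_WhileFalse.prems show ?case by cases (use exec_WhileFalse.hyps in auto)
qed (auto elim: exec.cases)

text \<open>Variable \<open>0\<close> holds the input at the start and the output at the end; all other variables
  initially contain \<open>Leaf\<close>.\<close>

definition computes :: "com \<Rightarrow> tree \<Rightarrow> tree \<Rightarrow> nat \<Rightarrow> bool" where
  "computes c x y t \<longleftrightarrow> (\<exists>s. exec c ((\<lambda>_. Leaf)(0 := x)) t s \<and> s 0 = y)"

definition poly_time_on :: "com \<Rightarrow> tree set \<Rightarrow> bool" where
  "poly_time_on c X \<longleftrightarrow>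
     (\<exists>p :: nat poly. \<forall>x\<in>X. \<exists>y t. computes c x y t \<and> t \<le> poly p (size x))"

text \<open>Numbers are encoded in unary, so that \<open>size (enc_nat N) = N\<close>.\<close>

fun enc_nat :: "nat \<Rightarrow> tree" where
  "enc_nat 0 = Leaf"
| "enc_nat (Suc n) = Node Leaf (enc_nat n)"

fun enc_gate :: "gate \<Rightarrow> tree" where
  "enc_gate (HAD q) = Node (enc_nat 0) (enc_nat q)"
| "enc_gate (PHASE q) = Node (enc_nat 1) (enc_nat q)"
| "enc_gate (NOT q) = Node (enc_nat 2) (enc_nat q)"
| "enc_gate (CNOT a b) = Node (enc_nat 3) (Node (enc_nat a) (enc_nat b))"
| "enc_gate (CPHASE a b) = Node (enc_nat 4) (Node (enc_nat a) (enc_nat b))"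

fun enc_circuit :: "gate list \<Rightarrow> tree" where
  "enc_circuit [] = Leaf"
| "enc_circuit (g # gs) = Node (enc_gate g) (enc_circuit gs)"

definition enc_input :: "nat \<Rightarrow> gate list \<Rightarrow> tree" where
  "enc_input N gs = Node (enc_nat N) (enc_circuit gs)"

definition enc_rounds :: "gate list \<Rightarrow> gate list \<Rightarrow> gate list \<Rightarrow> tree" where
  "enc_rounds r1 r2 r3 = Node (enc_circuit r1) (Node (enc_circuit r2) (enc_circuit r3))"

definition uniform_family :: "(nat \<Rightarrow> gate list) \<Rightarrow> bool" where
  "uniform_family C \<longleftrightarrow>
     (\<exists>c (p :: nat poly). \<forall>N\<ge>1. \<exists>t \<le> poly p N. computes c (enc_nat N) (enc_circuit (C N)) t)"

end

theory Submission
  imports Defs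
begin

text \<open>Every state reached by a Clifford circuit from \<open>|0\<dots>0\<rangle>\<close> has amplitudes
  \<open>\<alpha> [z\<^sub>r = f\<^sub>r(z) for all r] \<i> ^ (\<Sum>\<^sub>j l\<^sub>j(z))\<close> with affine functionals \<open>f\<^sub>r\<close> and \<open>l\<^sub>j\<close> over the field with
  two elements, where \<open>f\<^sub>q = z\<^sub>q\<close> for the pivot qubits \<open>q\<close> and all functionals depend on pivots only.
  From this form the rounds are read off: Hadamard gates on the pivots, then \<open>f\<^sub>r\<close> computed into the
  other qubits, then the phases. PHASE and CPHASE only add functionals \<open>l\<^sub>j\<close>, and NOT and CNOT reduce
  to them by Hadamard gates. A Hadamard gate on \<open>q\<close> makes \<open>q\<close> a pivot if it is none. If \<open>q\<close> is a
  pivot, it is first exchanged for a qubit \<open>r\<close> whose \<open>f\<^sub>r\<close> depends on \<open>q\<close>. If there is no such \<open>r\<close>,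
  then, with \<open>c\<close> the number of \<open>l\<^sub>j\<close> that contain \<open>q\<close> and \<open>m\<close> the sum of their remaining parts, the
  gate yields the factor \<open>1 + (-1) ^ (z\<^sub>q + m(z)) \<i> ^ c\<close>: a phase if \<open>c\<close> is odd, and the constraint
  \<open>z\<^sub>q = m(z) + c/2\<close> if \<open>c\<close> is even. A gate adds boundedly many functionals, so all sizes stay
  polynomial, and the functions computable in polynomial time are closed under composition and
  under folds with polynomially bounded intermediate results.\<close>

section \<open>Polynomial-time functions\<close>

text \<open>The phase is kept as an unreduced list \<open>L\<close> of 0/1-valued functionals whose
  sum is the exponent of \<i>, not as a quadratic form with coefficients modulo 4. Phase gates then
  only append, and a Hadamard gate on a pivot only has to count the functionals that contain it. The
  list grows by at most five entries per gate of the expanded circuit. The scalar \<alpha> is never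
  computed. \<open>represents\<close> records only its modulus, which agrees with the amplitude that
  round 1 produces on the same pivots; the quotient is therefore a phase, without any appeal to
  unitarity. \<open>ptime\<close> quantifies over all values of a type, malformed circuits included.
  So the functions of the algorithm have explicit defaults, and size bounds cannot rest on the
  correctness invariants. Sizes can explode only by iteration, which is why closure under folds asks
  for a bound on every intermediate accumulator. A program that generates a uniform family obeys no
  discipline about scratch variables and has to be wrapped before it can be composed.\<close>

class enc =
  fixes enc :: "'a \<Rightarrow> tree"

instantiation unit :: enc
begin
definition enc_unit :: "unit \<Rightarrow> tree" where "enc_unit u = Leaf"
instance ..
end

instantiation bool :: enc
begin
definition enc_bool :: "bool \<Rightarrow> tree" where "enc_bool b = (if b then Node Leaf Leaf else Leaf)"
instance ..
end

instantiation nat :: enc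
begin
definition enc_nat_inst: "enc n = enc_nat n"
instance ..
end

instantiation gate :: enc
begin
definition enc_gate_inst: "enc g = enc_gate g"
instance ..
end

instantiation prod :: (enc, enc) enc
begin
definition enc_prod :: "'a \<times> 'b \<Rightarrow> tree" where "enc_prod p = Node (enc (fst p)) (enc (snd p))"
instance ..
end

instantiation list :: (enc) enc
begin
primrec enc_list :: "'a list \<Rightarrow> tree" where
  "enc_list [] = Leaf"
| "enc_list (x # xs) = Node (enc x) (enc_list xs)"
instance ..
end

lemma enc_simps [simp]:
  "enc () = Leaf" "enc False = Leaf" "enc True = Node Leaf Leaf"
  "enc (0::nat) = Leaf" "enc (Suc n) = Node Leaf (enc n)"
  "enc (a, b) = Node (enc a) (enc b)"
  by (simp_all add: enc_unit_def enc_bool_def enc_nat_inst enc_prod_def)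

lemma enc_prod_fst_snd: "enc p = Node (enc (fst p)) (enc (snd p))"
  by (rule enc_prod_def)

lemma enc_circuit_eq: "enc_circuit gs = enc gs"
  by (induction gs) (auto simp: enc_gate_inst)

lemma enc_input_eq: "enc_input N gs = enc (N, gs)"
  by (simp add: enc_input_def enc_circuit_eq enc_nat_inst)

lemma enc_rounds_eq: "enc_rounds r1 r2 r3 = enc (r1, r2, r3)"
  by (simp add: enc_rounds_def enc_circuit_eq)

lemma size_enc_nat [simp]: "size (enc (n::nat)) = n"
  by (induction n) auto

lemma enc_replicate_unit: "enc (replicate n ()) = enc n"
  by (induction n) auto

lemma size_enc_append [simp]: "size (enc (xs @ ys)) = size (enc xs) + size (enc ys)"
  by (induction xs) auto

lemma size_enc_rev [simp]: "size (enc (rev xs)) = size (enc xs)"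
  by (induction xs) auto

lemma length_le_size_enc: "length xs \<le> size (enc xs)"
  by (induction xs) auto

lemma size_enc_mem: "x \<in> set xs \<Longrightarrow> size (enc x) < size (enc xs)"
  by (induction xs) auto

lemma size_enc_le: "(\<And>x. x \<in> set xs \<Longrightarrow> size (enc x) \<le> B) \<Longrightarrow> size (enc xs) \<le> length xs * Suc B"
proof (induction xs)
  case (Cons x xs)
  then have "size (enc x) \<le> B" "size (enc xs) \<le> length xs * Suc B" by auto
  then show ?case by simp
qed auto

lemma size_enc_filter_le: "size (enc (filter P xs)) \<le> size (enc xs)"
  by (induction xs) auto

lemma poly_nat_mono: "m \<le> n \<Longrightarrow> poly p m \<le> poly (p :: nat poly) n"
  by (induction p) (auto intro!: add_mono mult_mono)

section \<open>Execution within a time bound and composable implementations\<close>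

definition runs :: "com \<Rightarrow> store \<Rightarrow> store \<Rightarrow> nat \<Rightarrow> bool" where
  "runs c s s' T \<longleftrightarrow> (\<exists>t\<le>T. exec c s t s')"

lemma runs_Assign: "s' = s(x := eval_exp e s) \<Longrightarrow> 1 + cost e s \<le> T \<Longrightarrow> runs (Assign x e) s s' T"
  unfolding runs_def by (blast intro: exec_Assign)

lemma runs_Seq: "runs c s s1 T1 \<Longrightarrow> runs d s1 s2 T2 \<Longrightarrow> T1 + T2 \<le> T \<Longrightarrow> runs (Seq c d) s s2 T"
  unfolding runs_def by (meson exec_Seq add_mono order_trans)

lemma runs_mono: "runs c s s' T \<Longrightarrow> T \<le> T' \<Longrightarrow> runs c s s' T'"
  unfolding runs_def by (meson order_trans)

lemma runs_If:
  assumes "eval_exp e s \<noteq> Leaf \<Longrightarrow> runs c s s' T" "eval_exp e s = Leaf \<Longrightarrow> runs d s s' T"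
    and "1 + cost e s + T \<le> T'"
  shows "runs (If e c d) s s' T'"
proof (cases "eval_exp e s = Leaf")
  case True
  with assms obtain t where "t \<le> T" "exec d s t s'" by (auto simp: runs_def)
  then have "exec (If e c d) s (1 + cost e s + t) s'" using True by (intro exec_IfFalse)
  with \<open>t \<le> T\<close> assms(3) show ?thesis unfolding runs_def
    by (intro exI[of _ "1 + cost e s + t"]) auto
next
  case False
  with assms obtain t where "t \<le> T" "exec c s t s'" by (auto simp: runs_def)
  then have "exec (If e c d) s (1 + cost e s + t) s'" using False by (intro exec_IfTrue)
  with \<open>t \<le> T\<close> assms(3) show ?thesis unfolding runs_def
    by (intro exI[of _ "1 + cost e s + t"]) auto
qed

lemma runs_WhileFalse: "eval_exp e s = Leaf \<Longrightarrow> 1 + cost e s \<le> T \<Longrightarrow> runs (While e c) s s T"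
  unfolding runs_def by (blast intro: exec_WhileFalse)

lemma runs_WhileTrue:
  assumes "eval_exp e s \<noteq> Leaf" "runs c s s1 T1" "runs (While e c) s1 s2 T2"
    and "1 + cost e s + T1 + T2 \<le> T"
  shows "runs (While e c) s s2 T"
proof -
  obtain t1 t2 where "t1 \<le> T1" "exec c s t1 s1" "t2 \<le> T2" "exec (While e c) s1 t2 s2"
    using assms by (auto simp: runs_def)
  then have "exec (While e c) s (1 + cost e s + t1 + t2) s2"
    using assms(1) by (blast intro: exec_WhileTrue)
  with \<open>t1 \<le> T1\<close> \<open>t2 \<le> T2\<close> assms(4) show ?thesis unfolding runs_def
    by (intro exI[of _ "1 + cost e s + t1 + t2"]) auto
qed

text \<open>The program may use variables below \<open>m\<close> as scratch space if it finds and leaves them empty;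
  all others keep their contents. This makes implementations composable.\<close>

definition implements :: "com \<Rightarrow> nat \<Rightarrow> nat poly \<Rightarrow> ('a::enc \<Rightarrow> 'b::enc) \<Rightarrow> bool" where
  "implements c m p f \<longleftrightarrow> (\<forall>x s. s 0 = enc x \<and> (\<forall>i. 0 < i \<and> i < m \<longrightarrow> s i = Leaf) \<longrightarrow>
     size (enc (f x)) \<le> poly p (size (enc x)) \<and>
     runs c s (s(0 := enc (f x))) (poly p (size (enc x))))"

definition ptime :: "('a::enc \<Rightarrow> 'b::enc) \<Rightarrow> bool" where
  "ptime f \<longleftrightarrow> (\<exists>c m p. implements c m p f)"

lemma implements_mono: "implements c m p f \<Longrightarrow> m \<le> m' \<Longrightarrow> implements c m' p f"
  unfolding implements_def by (meson order_less_le_trans)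

lemma implementsD:
  assumes "implements c m p f" "s 0 = enc x" "\<And>i. 0 < i \<Longrightarrow> i < m \<Longrightarrow> s i = Leaf"
  shows "runs c s (s(0 := enc (f x))) (poly p (size (enc x)))"
  using assms unfolding implements_def by blast

lemma implements_size:
  assumes "implements c m p f"
  shows "size (enc (f x)) \<le> poly p (size (enc x))"
proof -
  show ?thesis
    using assms[unfolded implements_def, rule_format, of "\<lambda>i. if i = 0 then enc x else Leaf" x] by simp
qed

lemma ptime_size:
  assumes "ptime f"
  obtains p where "\<And>x. size (enc (f x)) \<le> poly p (size (enc x))"
  using assms implements_size unfolding ptime_def by metis

fun input_only :: "exp \<Rightarrow> bool" where
  "input_only (Var x) \<longleftrightarrow> x = 0"
| "input_only LeafE \<longleftrightarrow> True"
| "input_only (NodeE a b) \<longleftrightarrow> input_only a \<and> input_only b"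
| "input_only (LeftE a) \<longleftrightarrow> input_only a"
| "input_only (RightE a) \<longleftrightarrow> input_only a"

lemma input_only_eval: "input_only e \<Longrightarrow> s 0 = s' 0 \<Longrightarrow> eval_exp e s = eval_exp e s'"
  by (induction e) auto

lemma size_left_le: "size (left a) \<le> size a"
  by (cases a) auto

lemma size_right_le: "size (right a) \<le> size a"
  by (cases a) auto

lemma size_eval_exp_le: "size (eval_exp e s) \<le> cost e s"
proof (induction e)
  case (LeftE e)
  then show ?case using size_left_le[of "eval_exp e s"] by simp
next
  case (RightE e)
  then show ?case using size_right_le[of "eval_exp e s"] by simp
qed auto

text \<open>An expression has at most \<open>size e\<close> inner nodes and
  \<open>size e + 1\<close> leaves, and a leaf costs at most one more than the size of the
  input.\<close>

lemma input_only_cost: "input_only e \<Longrightarrow> cost e s \<le> size e + (size e + 1) * (1 + size (s 0))"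
  by (induction e) (auto simp: algebra_simps)

text \<open>A single assignment to variable \<open>0\<close>, without scratch space. Constants, tree
  constructors and projections enter the calculus this way.\<close>

lemma ptime_exp:
  fixes f :: "'a::enc \<Rightarrow> 'b::enc"
  assumes "input_only e" and eq: "\<And>x. enc (f x) = eval_exp e (\<lambda>_. enc x)"
  shows "ptime f"
proof -
  let ?p = "[:size e + (size e + 1) + 1, size e + 1:]"
  have cost: "1 + cost e s \<le> poly ?p (size (s 0))" for s
    using input_only_cost[OF assms(1), of s] by (simp add: algebra_simps)
  have "implements (Assign 0 e) 1 ?p f"
    unfolding implements_def
  proof (intro allI impI conjI)
    fix x :: 'a and s :: store
    assume s: "s 0 = enc x \<and> (\<forall>i. 0 < i \<and> i < 1 \<longrightarrow> s i = Leaf)"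
    then have ev: "eval_exp e s = enc (f x)"
      using eq input_only_eval[OF assms(1), of s "\<lambda>_. enc x"] by simp
    show "size (enc (f x)) \<le> poly ?p (size (enc x))"
      using size_eval_exp_le[of e s] cost[of s] s ev by simp
    show "runs (Assign 0 e) s (s(0 := enc (f x))) (poly ?p (size (enc x)))"
      by (rule runs_Assign) (use cost[of s] s ev in auto)
  qed
  then show ?thesis unfolding ptime_def by blast
qed

text \<open>The size clause of \<open>implements\<close> bounds the input of the second program,
  hence \<open>pcompose q p\<close>.\<close>

lemma ptime_comp:
  fixes f :: "'a::enc \<Rightarrow> 'b::enc"
  assumes "ptime g" "ptime f"
  shows "ptime (\<lambda>x. g (f x))"
proof -
  obtain c m p where f: "implements c m p f" using assms(2) unfolding ptime_def by blast
  obtain d n q where g: "implements d n q g" using assms(1) unfolding ptime_def by blast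
  let ?r = "p + pcompose q p"
  have r: "poly p k + poly q (size (enc (f x))) \<le> poly ?r k" if "k = size (enc x)" for k x
    using implements_size[OF f, of x] poly_nat_mono that by (simp add: poly_pcompose)
  have "implements (Seq c d) (max m n) ?r (\<lambda>x. g (f x))"
    unfolding implements_def
  proof (intro allI impI conjI)
    fix x :: 'a and s :: store
    assume s: "s 0 = enc x \<and> (\<forall>i. 0 < i \<and> i < max m n \<longrightarrow> s i = Leaf)"
    show "size (enc (g (f x))) \<le> poly ?r (size (enc x))"
      using implements_size[OF g, of "f x"] r[OF refl, of x] by simp
    show "runs (Seq c d) s (s(0 := enc (g (f x)))) (poly ?r (size (enc x)))"
    proof (rule runs_Seq[OF _ _ r[OF refl]])
      show "runs c s (s(0 := enc (f x))) (poly p (size (enc x)))"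
        by (rule implementsD[OF f]) (use s in auto)
      show "runs d (s(0 := enc (f x))) (s(0 := enc (g (f x)))) (poly q (size (enc (f x))))"
        using implementsD[OF g, of "s(0 := enc (f x))" "f x"] s by simp
    qed
  qed
  then show ?thesis unfolding ptime_def by blast
qed

lemma ptime_Pair:
  fixes f :: "'a::enc \<Rightarrow> 'b::enc"
  assumes "ptime f" "ptime g"
  shows "ptime (\<lambda>x. (f x, g x))"
proof -
  obtain c1 m1 p where "implements c1 m1 p f" using assms(1) unfolding ptime_def by blast
  moreover obtain c2 m2 q where "implements c2 m2 q g" using assms(2) unfolding ptime_def by blast
  \<comment> \<open>Variables \<open>m\<close> and \<open>Suc m\<close> lie above the scratch space
    of both programs, so the saved input and the first result survive their runs; \<open>Suc\<close>
    keeps \<open>m\<close> apart from the input variable \<open>0\<close>.\<close>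
  moreover define m where "m = Suc (max m1 m2)"
  ultimately have f: "implements c1 m p f" and g: "implements c2 m q g"
    by (auto intro: implements_mono)
  define prog where "prog =
    Seq (Assign m (Var 0)) (Seq c1 (Seq (Assign (Suc m) (Var 0)) (Seq (Assign 0 (Var m))
    (Seq (Assign m LeafE) (Seq c2 (Seq (Assign 0 (NodeE (Var (Suc m)) (Var 0)))
    (Assign (Suc m) LeafE)))))))"
  let ?r = "[:20, 3:] + (p + p + p) + (q + q + q)"
  have "implements prog (m + 2) ?r (\<lambda>x. (f x, g x))"
    unfolding implements_def
  proof (intro allI impI conjI)
    fix x :: 'a and s :: store
    assume s: "s 0 = enc x \<and> (\<forall>i. 0 < i \<and> i < m + 2 \<longrightarrow> s i = Leaf)"
    note sz = implements_size[OF f, of x] implements_size[OF g, of x]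
    show "size (enc (f x, g x)) \<le> poly ?r (size (enc x))"
      using sz by simp
    have m: "m > 0" by (simp add: m_def)
    define n where "n = size (enc x)"
    define s1 where "s1 = s(m := enc x)"
    define s2 where "s2 = s1(0 := enc (f x))"
    define s3 where "s3 = s2(Suc m := enc (f x))"
    define s4 where "s4 = s3(0 := enc x)"
    define s5 where "s5 = s4(m := Leaf)"
    define s6 where "s6 = s5(0 := enc (g x))"
    define s7 where "s7 = s6(0 := enc (f x, g x))"
    have "runs prog s (s(0 := enc (f x, g x)))
      ((n + 2) + (poly p n + ((poly p n + 2) + ((n + 2) + (2 + (poly q n + ((poly p n + poly q n + 4) + 2)))))))"
      unfolding prog_def
    proof (intro runs_Seq)
      show "runs (Assign m (Var 0)) s s1 (n + 2)"
        by (rule runs_Assign) (use s in \<open>auto simp: s1_def n_def\<close>)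
      show "runs c1 s1 s2 (poly p n)"
        unfolding s2_def n_def by (rule implementsD[OF f]) (use s m in \<open>auto simp: s1_def\<close>)
      show "runs (Assign (Suc m) (Var 0)) s2 s3 (poly p n + 2)"
        by (rule runs_Assign) (use sz in \<open>auto simp: s2_def s3_def n_def\<close>)
      show "runs (Assign 0 (Var m)) s3 s4 (n + 2)"
        by (rule runs_Assign) (use m in \<open>auto simp: s1_def s2_def s3_def s4_def n_def\<close>)
      show "runs (Assign m LeafE) s4 s5 2"
        by (rule runs_Assign) (auto simp: s5_def)
      show "runs c2 s5 s6 (poly q n)"
        unfolding s6_def n_def
        by (rule implementsD[OF g]) (use s m in \<open>auto simp: s1_def s2_def s3_def s4_def s5_def\<close>)
      show "runs (Assign 0 (NodeE (Var (Suc m)) (Var 0))) s6 s7 (poly p n + poly q n + 4)"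
        by (rule runs_Assign)
          (use s m sz in \<open>auto simp: s1_def s2_def s3_def s4_def s5_def s6_def s7_def n_def\<close>)
      show "runs (Assign (Suc m) LeafE) s7 (s(0 := enc (f x, g x))) 2"
        by (rule runs_Assign)
          (use s m in \<open>auto simp: s1_def s2_def s3_def s4_def s5_def s6_def s7_def fun_eq_iff\<close>)
    qed (rule order_refl)+
    then show "runs prog s (s(0 := enc (f x, g x))) (poly ?r (size (enc x)))"
      by (rule runs_mono) (simp add: n_def)
  qed
  then show ?thesis unfolding ptime_def by blast
qed

text \<open>The value of the test travels in a pair with the input, so the program branches on the
  left component and hands on the right one. Testing any encoding against \<open>Leaf\<close> covers
  truth values as well as emptiness of lists.\<close>

lemma ptime_if_enc:
  fixes f :: "'a::enc \<Rightarrow> 'b::enc" and b :: "'a \<Rightarrow> 'c::enc"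
  assumes b: "ptime b" and f: "ptime f" and g: "ptime g"
  shows "ptime (\<lambda>x. if enc (b x) \<noteq> Leaf then f x else g x)"
proof -
  define h :: "'c \<times> 'a \<Rightarrow> 'b" where "h = (\<lambda>z. if enc (fst z) \<noteq> Leaf then f (snd z) else g (snd z))"
  obtain c1 m1 p where f: "implements c1 m1 p f" using f unfolding ptime_def by blast
  obtain c2 m2 q where g: "implements c2 m2 q g" using g unfolding ptime_def by blast
  define prog where "prog = If (LeftE (Var 0)) (Seq (Assign 0 (RightE (Var 0))) c1) (Seq (Assign 0 (RightE (Var 0))) c2)"
  let ?r = "[:6, 2:] + p + q"
  have "implements prog (max m1 m2) ?r h"
    unfolding implements_def
  proof (intro allI impI conjI)
    fix z :: "'c \<times> 'a" and s :: store
    assume s: "s 0 = enc z \<and> (\<forall>i. 0 < i \<and> i < max m1 m2 \<longrightarrow> s i = Leaf)"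
    define n where "n = size (enc z)"
    have le: "size (enc (snd z)) \<le> n" by (simp add: enc_prod_fst_snd n_def)
    have mono: "poly p (size (enc (snd z))) \<le> poly p n" "poly q (size (enc (snd z))) \<le> poly q n"
      using le poly_nat_mono by blast+
    show "size (enc (h z)) \<le> poly ?r (size (enc z))"
      using implements_size[OF f, of "snd z"] implements_size[OF g, of "snd z"] mono
      by (auto simp: h_def n_def)
    define s1 where "s1 = s(0 := enc (snd z))"
    have a: "runs (Assign 0 (RightE (Var 0))) s s1 (n + 3)"
      by (rule runs_Assign) (use s in \<open>auto simp: s1_def enc_prod_fst_snd n_def\<close>)
    have "runs prog s (s(0 := enc (h z))) (1 + cost (LeftE (Var 0)) s + ((n + 3) + (poly p n + poly q n)))"
      unfolding prog_def
    proof (rule runs_If[OF _ _ order_refl])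
      assume "eval_exp (LeftE (Var 0)) s \<noteq> Leaf"
      then have "h z = f (snd z)" using s by (auto simp: h_def enc_prod_fst_snd)
      moreover have "runs c1 s1 (s1(0 := enc (f (snd z)))) (poly p (size (enc (snd z))))"
        by (rule implementsD[OF f]) (use s in \<open>auto simp: s1_def\<close>)
      ultimately show "runs (Seq (Assign 0 (RightE (Var 0))) c1) s (s(0 := enc (h z))) ((n + 3) + (poly p n + poly q n))"
        using mono by (intro runs_Seq[OF a]) (auto simp: s1_def)
    next
      assume "eval_exp (LeftE (Var 0)) s = Leaf"
      then have "h z = g (snd z)" using s by (auto simp: h_def enc_prod_fst_snd)
      moreover have "runs c2 s1 (s1(0 := enc (g (snd z)))) (poly q (size (enc (snd z))))"
        by (rule implementsD[OF g]) (use s in \<open>auto simp: s1_def\<close>)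
      ultimately show "runs (Seq (Assign 0 (RightE (Var 0))) c2) s (s(0 := enc (h z))) ((n + 3) + (poly p n + poly q n))"
        using mono by (intro runs_Seq[OF a]) (auto simp: s1_def)
    qed
    then show "runs prog s (s(0 := enc (h z))) (poly ?r (size (enc z)))"
      by (rule runs_mono) (use s in \<open>simp add: n_def\<close>)
  qed
  then have "ptime h" unfolding ptime_def by blast
  moreover have "ptime (\<lambda>x. x :: 'a)" by (rule ptime_exp[of "Var 0"]) auto
  ultimately have "ptime (\<lambda>x. h (b x, x))"
    using ptime_comp[of h "\<lambda>x. (b x, x)"] ptime_Pair[of b "\<lambda>x. x"] b by blast
  then show ?thesis by (simp add: h_def cong: if_cong)
qed

text \<open>The source \<open>h\<close> of the arguments is built in because the accumulators may be
  small only on triples of the form \<open>h z\<close>: as a function of arbitrary triples the fold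
  need not be polynomial. During the loop, variable \<open>m\<close> holds the environment and
  \<open>Suc m\<close> the rest of the list.\<close>

lemma ptime_foldl_aux:
  fixes f :: "'e::enc \<times> 'a::enc \<times> 'x::enc \<Rightarrow> 'a" and h :: "'z::enc \<Rightarrow> 'e \<times> 'a \<times> 'x list"
  assumes f: "ptime f"
    and bound: "\<And>z k. size (enc (foldl (\<lambda>a x. f (fst (h z), a, x)) (fst (snd (h z))) (take k (snd (snd (h z)))))) \<le> poly q (size (enc (h z)))"
    and h: "ptime h"
  shows "ptime (\<lambda>z. foldl (\<lambda>a x. f (fst (h z), a, x)) (fst (snd (h z))) (snd (snd (h z))))"
proof -
  obtain c m1 p where "implements c m1 p f" using f unfolding ptime_def by blast
  moreover define m where "m = Suc m1"
  ultimately have f: "implements c m p f" and m: "m > 0" by (auto intro: implements_mono)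
  obtain ch mh ph where h: "implements ch mh ph h" using h unfolding ptime_def by blast
  define body where "body = Seq (Assign 0 (NodeE (Var m) (NodeE (Var 0) (LeftE (Var (Suc m))))))
    (Seq c (Assign (Suc m) (RightE (Var (Suc m)))))"
  define prog where "prog = Seq (Assign m (LeftE (Var 0))) (Seq (Assign (Suc m) (RightE (RightE (Var 0))))
    (Seq (Assign 0 (LeftE (RightE (Var 0)))) (Seq (While (Var (Suc m)) body) (Assign m LeafE))))"
  \<comment> \<open>The argument of the loop body consists of two pair nodes, the environment and a
    list element of size at most n each, and an accumulator of size at most
    \<open>poly q n\<close>.\<close>
  let ?p' = "pcompose p ([:2, 2:] + q)"
  let ?iter = "[:20, 10:] + q + ?p'"
  let ?r = "[:20, 10:] + ([:1, 1:] * ?iter) + q"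
  have iter: "runs (While (Var (Suc m)) body)
      (\<lambda>i. if i = 0 then enc a else if i = m then enc e else if i = Suc m then enc l else s i)
      (\<lambda>i. if i = 0 then enc (foldl (\<lambda>a x. f (e, a, x)) a l) else if i = m then enc e else if i = Suc m then Leaf else s i)
      (Suc (length l) * poly ?iter n)"
    if "\<And>k. size (enc (foldl (\<lambda>a x. f (e, a, x)) a (take k l))) \<le> poly q n" "size (enc e) \<le> n" "size (enc l) \<le> n"
      "\<And>i. 0 < i \<Longrightarrow> i < m \<Longrightarrow> s i = Leaf" for e a l n and s :: store
    using that
  proof (induction l arbitrary: a)
    case Nil
    show ?case unfolding foldl_Nil enc_list.simps
      by (rule runs_WhileFalse) (use m in auto)
  next
    case (Cons x l)
    have a: "size (enc a) \<le> poly q n" using Cons.prems(1)[of 0] by simp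
    have a': "size (enc (foldl (\<lambda>a x. f (e, a, x)) (f (e, a, x)) (take k l))) \<le> poly q n" for k
      using Cons.prems(1)[of "Suc k"] by simp
    from a'[of 0] have fa: "size (enc (f (e, a, x))) \<le> poly q n" by simp
    have xl: "size (enc x) + size (enc l) < n" using Cons.prems(3) by simp
    let ?st = "\<lambda>a l i. if i = 0 then enc a else if i = m then enc e else if i = Suc m then enc l else s i"
    define s1 where "s1 = (?st a (x # l))(0 := enc (e, a, x))"
    define s2 where "s2 = s1(0 := enc (f (e, a, x)))"
    have "size (enc (e, a, x)) \<le> poly ([:2, 2:] + q) n"
      using a xl Cons.prems(2) by simp
    then have pp: "poly p (size (enc (e, a, x))) \<le> poly ?p' n"
      unfolding poly_pcompose by (rule poly_nat_mono)
    have body: "runs body (?st a (x # l)) (?st (f (e, a, x)) l)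
      ((2 * n + poly q n + 10) + (poly p (size (enc (e, a, x))) + (n + 4)))"
      unfolding body_def
    proof (intro runs_Seq)
      show "runs (Assign 0 (NodeE (Var m) (NodeE (Var 0) (LeftE (Var (Suc m)))))) (?st a (x # l)) s1 (2 * n + poly q n + 10)"
        by (rule runs_Assign) (use m a xl Cons.prems(2) in \<open>auto simp: s1_def\<close>)
      show "runs c s1 s2 (poly p (size (enc (e, a, x))))"
        unfolding s2_def by (rule implementsD[OF f]) (use m Cons.prems(4) in \<open>auto simp: s1_def\<close>)
      show "runs (Assign (Suc m) (RightE (Var (Suc m)))) s2 (?st (f (e, a, x)) l) (n + 4)"
        by (rule runs_Assign) (use m xl in \<open>auto simp: s1_def s2_def fun_eq_iff\<close>)
    qed (rule order_refl)+
    have rest: "runs (While (Var (Suc m)) body) (?st (f (e, a, x)) l)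
      (\<lambda>i. if i = 0 then enc (foldl (\<lambda>a x. f (e, a, x)) a (x # l)) else if i = m then enc e else if i = Suc m then Leaf else s i)
      (Suc (length l) * poly ?iter n)"
      unfolding foldl_Cons using Cons.prems xl by (intro Cons.IH a') auto
    show ?case
      by (rule runs_WhileTrue[OF _ body rest]) (use xl pp m in auto)
  qed
  let ?g = "\<lambda>z. foldl (\<lambda>a x. f (fst z, a, x)) (fst (snd z)) (snd (snd z))"
  have loop: "runs prog s (s(0 := enc (?g (h w)))) (poly ?r (size (enc (h w))))"
    if s: "s 0 = enc (h w)" "\<And>i. 0 < i \<Longrightarrow> i < m + 2 \<Longrightarrow> s i = Leaf" for w s
  proof -
    obtain e a l where z: "h w = (e, a, l)" by (metis prod.exhaust)
    define n where "n = size (enc (e, a, l))"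
    define s1 where "s1 = s(m := enc e)"
    define s2 where "s2 = s1(Suc m := enc l)"
    have "runs prog s (s(0 := enc (?g (e, a, l)))) ((n + 3) + ((n + 4) + ((n + 4) + (Suc (length l) * poly ?iter n + 2))))"
      unfolding prog_def
    proof (intro runs_Seq)
      show "runs (Assign m (LeftE (Var 0))) s s1 (n + 3)"
        by (rule runs_Assign) (use s z in \<open>auto simp: s1_def n_def\<close>)
      show "runs (Assign (Suc m) (RightE (RightE (Var 0)))) s1 s2 (n + 4)"
        by (rule runs_Assign) (use s z m in \<open>auto simp: s1_def s2_def n_def\<close>)
      show "runs (Assign 0 (LeftE (RightE (Var 0)))) s2
        (\<lambda>i. if i = 0 then enc a else if i = m then enc e else if i = Suc m then enc l else s i) (n + 4)"
        by (rule runs_Assign) (use s z m in \<open>auto simp: s1_def s2_def n_def fun_eq_iff\<close>)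
      show "runs (While (Var (Suc m)) body) (\<lambda>i. if i = 0 then enc a else if i = m then enc e else if i = Suc m then enc l else s i)
         (\<lambda>i. if i = 0 then enc (foldl (\<lambda>a x. f (e, a, x)) a l) else if i = m then enc e else if i = Suc m then Leaf else s i)
         (Suc (length l) * poly ?iter n)"
        by (rule iter) (use bound[of w] z s in \<open>auto simp: n_def\<close>)
      show "runs (Assign m LeafE) (\<lambda>i. if i = 0 then enc (foldl (\<lambda>a x. f (e, a, x)) a l) else if i = m then enc e else if i = Suc m then Leaf else s i)
         (s(0 := enc (?g (e, a, l)))) 2"
        by (rule runs_Assign) (use s m in \<open>auto simp: fun_eq_iff\<close>)
    qed (rule order_refl)+
    moreover {
    have "length l \<le> n" using length_le_size_enc[of l] by (simp add: n_def)
    then have "Suc (length l) * poly ?iter n \<le> poly ([:1, 1:] * ?iter) n"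
      unfolding poly_mult by (intro mult_right_mono) auto
    moreover have "poly ?r n = 20 + 10 * n + poly ([:1, 1:] * ?iter) n + poly q n"
      by (simp only: poly_add poly_pCons) simp
    ultimately have "(n + 3) + ((n + 4) + ((n + 4) + (Suc (length l) * poly ?iter n + 2))) \<le> poly ?r n"
      by linarith
    }
    ultimately show ?thesis unfolding z n_def by (rule runs_mono)
  qed
  have "implements (Seq ch prog) (max mh (m + 2)) (ph + pcompose ?r ph) (\<lambda>w. ?g (h w))"
    unfolding implements_def
  proof (intro allI impI conjI)
    fix w :: 'z and s :: store
    assume s: "s 0 = enc w \<and> (\<forall>i. 0 < i \<and> i < max mh (m + 2) \<longrightarrow> s i = Leaf)"
    note sz = poly_nat_mono[OF implements_size[OF h], of ?r w]
    have "size (enc (?g (h w))) \<le> poly ?r (size (enc (h w)))"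
      using bound[of w "length (snd (snd (h w)))"] by simp
    then show "size (enc (?g (h w))) \<le> poly (ph + pcompose ?r ph) (size (enc w))"
      using sz unfolding poly_add[of ph] poly_pcompose[of ?r] by linarith
    have A: "runs ch s (s(0 := enc (h w))) (poly ph (size (enc w)))"
      by (rule implementsD[OF h]) (use s in auto)
    have B: "runs prog (s(0 := enc (h w))) ((s(0 := enc (h w)))(0 := enc (?g (h w)))) (poly ?r (size (enc (h w))))"
      by (rule loop) (use s in auto)
    show "runs (Seq ch prog) s (s(0 := enc (?g (h w)))) (poly (ph + pcompose ?r ph) (size (enc w)))"
      by (rule runs_mono[OF runs_Seq[OF A B[unfolded fun_upd_upd] order_refl]])
        (use sz in \<open>simp only: poly_add[of ph] poly_pcompose[of ?r] add_left_mono\<close>)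
  qed
  then show ?thesis unfolding ptime_def by blast
qed

lemma ptime_foldl:
  fixes f :: "'z::enc \<Rightarrow> 'a::enc \<Rightarrow> 'x::enc \<Rightarrow> 'a"
  assumes f: "ptime (\<lambda>p. f (fst p) (fst (snd p)) (snd (snd p)))" and g: "ptime g" and h: "ptime h"
    and bound: "\<And>z k. size (enc (foldl (f z) (g z) (take k (h z)))) \<le> poly q (size (enc z))"
  shows "ptime (\<lambda>z. foldl (f z) (g z) (h z))"
proof -
  have id: "ptime (\<lambda>z. z :: 'z)" by (rule ptime_exp[of "Var 0"]) auto
  have "size (enc (foldl (f z) (g z) (take k (h z)))) \<le> poly q (size (enc (z, g z, h z)))" for z k
    using bound[of z k] poly_nat_mono[of "size (enc z)" "size (enc (z, g z, h z))" q]
    by (simp add: order_trans)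
  with ptime_foldl_aux[OF f, of "\<lambda>z. (z, g z, h z)" q] show ?thesis
    by (simp add: ptime_Pair id g h)
qed

text \<open>Growth by an amount that depends on \<open>z\<close> alone adds up to at most length
  times amount. A bound proportional to the accumulator would not do, since repeated doubling is
  exponential.\<close>

lemma ptime_foldl_additive:
  fixes f :: "'z::enc \<Rightarrow> 'a::enc \<Rightarrow> 'x::enc \<Rightarrow> 'a"
  assumes f: "ptime (\<lambda>p. f (fst p) (fst (snd p)) (snd (snd p)))" and g: "ptime g" and h: "ptime h"
    and step: "\<And>z a x. x \<in> set (h z) \<Longrightarrow> size (enc (f z a x)) \<le> size (enc a) + poly q (size (enc z))"
  shows "ptime (\<lambda>z. foldl (f z) (g z) (h z))"
proof -
  obtain pg where pg: "\<And>z. size (enc (g z)) \<le> poly pg (size (enc z))" using ptime_size[OF g] by blast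
  obtain ph where ph: "\<And>z. size (enc (h z)) \<le> poly ph (size (enc z))" using ptime_size[OF h] by blast
  have fold: "size (enc (foldl (f z) a xs)) \<le> size (enc a) + length xs * poly q (size (enc z))"
    if "set xs \<subseteq> set (h z)" for z a xs
    using that
  proof (induction xs arbitrary: a)
    case (Cons x xs)
    have "size (enc (foldl (f z) (f z a x) xs)) \<le> size (enc (f z a x)) + length xs * poly q (size (enc z))"
      by (rule Cons.IH) (use Cons.prems in simp)
    moreover have "size (enc (f z a x)) \<le> size (enc a) + poly q (size (enc z))"
      by (rule step) (use Cons.prems in simp)
    ultimately show ?case by simp
  qed auto
  have "size (enc (foldl (f z) (g z) (take k (h z)))) \<le> poly (pg + ph * q) (size (enc z))" for z k
  proof -
    have "length (take k (h z)) \<le> poly ph (size (enc z))"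
      using ph[of z] length_le_size_enc[of "h z"] by simp
    then have "length (take k (h z)) * poly q (size (enc z)) \<le> poly ph (size (enc z)) * poly q (size (enc z))"
      by (rule mult_right_mono) simp
    then show ?thesis
      using fold[OF set_take_subset, of z "g z" k] pg[of z] unfolding poly_add poly_mult by linarith
  qed
  then show ?thesis by (rule ptime_foldl[OF f g h])
qed

section \<open>Closure properties of polynomial-time functions\<close>

named_theorems ptime_intros

lemma ptime_id [ptime_intros]: "ptime (\<lambda>x. x)"
  by (rule ptime_exp[of "Var 0"]) auto

fun quote_tree :: "tree \<Rightarrow> exp" where
  "quote_tree Leaf = LeafE"
| "quote_tree (Node a b) = NodeE (quote_tree a) (quote_tree b)"

lemma quote_tree: "input_only (quote_tree t)" "eval_exp (quote_tree t) s = t"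
  by (induction t) auto

lemma ptime_const [ptime_intros]: "ptime (\<lambda>x. c)"
  by (rule ptime_exp[of "quote_tree (enc c)"]) (auto simp: quote_tree)

lemmas [ptime_intros] = ptime_Pair

lemma ptime_fst [ptime_intros]: "ptime f \<Longrightarrow> ptime (\<lambda>x. fst (f x))"
  by (rule ptime_comp[of fst]) (rule ptime_exp[of "LeftE (Var 0)"], auto simp: enc_prod_fst_snd)

lemma ptime_snd [ptime_intros]: "ptime f \<Longrightarrow> ptime (\<lambda>x. snd (f x))"
  by (rule ptime_comp[of snd]) (rule ptime_exp[of "RightE (Var 0)"], auto simp: enc_prod_fst_snd)

text \<open>Programs see values only through their encodings, so \<open>f'\<close> may have another
  result type: a number passes for a list of units, a tagged tuple for a gate.\<close>

lemma ptime_cong_enc: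
  assumes "ptime f" "\<And>x. enc (f' x) = enc (f x)"
  shows "ptime f'"
  using assms unfolding ptime_def implements_def by simp

lemma ptime_comp2:
  assumes "ptime (\<lambda>p. g (fst p) (snd p))" "ptime f1" "ptime f2"
  shows "ptime (\<lambda>x. g (f1 x) (f2 x))"
  using ptime_comp[OF assms(1) ptime_Pair[OF assms(2,3)]] by simp

lemma ptime_comp3:
  assumes "ptime (\<lambda>p. g (fst p) (fst (snd p)) (snd (snd p)))" "ptime f1" "ptime f2" "ptime f3"
  shows "ptime (\<lambda>x. g (f1 x) (f2 x) (f3 x))"
  using ptime_comp[OF assms(1) ptime_Pair[OF assms(2) ptime_Pair[OF assms(3,4)]]] by simp

lemma ptime_if [ptime_intros]:
  assumes "ptime b" "ptime f" "ptime g"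
  shows "ptime (\<lambda>x. if b x then f x else g x)"
  using ptime_if_enc[OF assms] by (rule ptime_cong_enc) (auto simp: enc_bool_def)

lemma ptime_not [ptime_intros]: "ptime b \<Longrightarrow> ptime (\<lambda>x. \<not> b x)"
  by (rule ptime_cong_enc[OF ptime_if[of b "\<lambda>_. False" "\<lambda>_. True"]]) (auto intro: ptime_const)

lemma ptime_conj [ptime_intros]: "ptime b \<Longrightarrow> ptime c \<Longrightarrow> ptime (\<lambda>x. b x \<and> c x)"
  by (rule ptime_cong_enc[OF ptime_if[of b c "\<lambda>_. False"]]) (auto intro: ptime_const)

lemma enc_list_eq_Leaf: "enc xs = Leaf \<longleftrightarrow> xs = []"
  by (cases xs) auto

lemma ptime_eq_Nil [ptime_intros]: "ptime f \<Longrightarrow> ptime (\<lambda>x. f x = [])"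
  by (rule ptime_cong_enc[OF ptime_if_enc[of f "\<lambda>_. False" "\<lambda>_. True"]])
    (auto intro: ptime_const simp: enc_list_eq_Leaf)

lemma ptime_Cons [ptime_intros]: "ptime f \<Longrightarrow> ptime g \<Longrightarrow> ptime (\<lambda>x. f x # g x)"
  by (rule ptime_cong_enc[OF ptime_Pair[of f g]]) auto

lemma ptime_tl [ptime_intros]:
  assumes "ptime f"
  shows "ptime (\<lambda>x. tl (f x))"
proof (rule ptime_comp[of tl, OF _ assms], rule ptime_exp[of "RightE (Var 0)"])
  show "enc (tl xs) = eval_exp (RightE (Var 0)) (\<lambda>_. enc xs)" for xs :: "'b list" by (cases xs) auto
qed auto

lemma ptime_foldl_Cons:
  assumes "ptime (f :: 'z::enc \<Rightarrow> 'x::enc list)" "ptime h"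
  shows "ptime (\<lambda>z. foldl (\<lambda>a x. x # a) (f z) (h z))"
proof -
  obtain p where p: "\<And>z. size (enc (h z)) \<le> poly p (size (enc z))" using ptime_size[OF assms(2)] by blast
  have "size (enc x) \<le> poly p (size (enc z))" if "x \<in> set (h z)" for x z
    using size_enc_mem[OF that] p[of z] by simp
  then show ?thesis
    by (intro ptime_foldl_additive[where q = "p + [:1:]"] ptime_intros assms) auto
qed

lemma foldl_Cons_eq: "foldl (\<lambda>a x. x # a) ys xs = rev xs @ ys"
  by (induction xs arbitrary: ys) auto

lemma ptime_rev [ptime_intros]: "ptime f \<Longrightarrow> ptime (\<lambda>x. rev (f x))"
  using ptime_foldl_Cons[of "\<lambda>_. []" f] by (simp add: foldl_Cons_eq ptime_const)

lemma ptime_append [ptime_intros]: "ptime f \<Longrightarrow> ptime g \<Longrightarrow> ptime (\<lambda>x. f x @ g x)"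
  using ptime_foldl_Cons[of g "\<lambda>x. rev (f x)"] by (simp add: foldl_Cons_eq ptime_rev)

lemma ptime_map [ptime_intros]:
  fixes f :: "'z::enc \<Rightarrow> 'x::enc \<Rightarrow> 'y::enc"
  assumes f: "ptime (\<lambda>p. f (fst p) (snd p))" and h: "ptime h"
  shows "ptime (\<lambda>z. map (f z) (h z))"
proof -
  obtain p where p: "\<And>z. size (enc (h z)) \<le> poly p (size (enc z))" using ptime_size[OF h] by blast
  obtain q where q: "\<And>w. size (enc (f (fst w) (snd w))) \<le> poly q (size (enc w))" using ptime_size[OF f] by blast
  have "size (enc (f z x)) \<le> poly (pcompose q ([:1, 1:] + p)) (size (enc z))" if "x \<in> set (h z)" for x z
  proof -
    have "size (enc (z, x)) \<le> poly ([:1, 1:] + p) (size (enc z))"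
      using size_enc_mem[OF that] p[of z] by simp
    from poly_nat_mono[OF this, of q] q[of "(z, x)"] show ?thesis
      unfolding poly_pcompose by simp
  qed
  then have "ptime (\<lambda>z. foldl (\<lambda>a x. f z x # a) [] (h z))"
    by (intro ptime_foldl_additive[where q = "pcompose q ([:1, 1:] + p) + [:1:]"]
        ptime_intros h ptime_comp2[OF f]) auto
  moreover have "foldl (\<lambda>a x. f z x # a) ys xs = rev (map (f z) xs) @ ys" for z xs ys
    by (induction xs arbitrary: ys) auto
  ultimately show ?thesis using ptime_rev by fastforce
qed

lemma ptime_concat [ptime_intros]:
  fixes h :: "'z::enc \<Rightarrow> 'x::enc list list"
  assumes h: "ptime h"
  shows "ptime (\<lambda>z. concat (h z))"
proof -
  obtain p where p: "\<And>z. size (enc (h z)) \<le> poly p (size (enc z))" using ptime_size[OF h] by blast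
  have "size (enc x) \<le> poly p (size (enc z))" if "x \<in> set (h z)" for x z
    using size_enc_mem[OF that] p[of z] by simp
  then have "ptime (\<lambda>z. foldl (@) [] (h z))"
    by (intro ptime_foldl_additive[where q = p] ptime_intros h) auto
  moreover have "foldl (@) ys xs = ys @ concat xs" for ys and xs :: "'x list list"
    by (induction xs arbitrary: ys) auto
  ultimately show ?thesis by simp
qed

lemma ptime_filter [ptime_intros]:
  assumes "ptime (\<lambda>p. P (fst p) (snd p))" and "ptime h"
  shows "ptime (\<lambda>z. filter (P z) (h z))"
proof -
  have "ptime (\<lambda>z. concat (map (\<lambda>x. if P z x then [x] else []) (h z)))"
    by (intro ptime_intros assms)
  moreover have "concat (map (\<lambda>x. if P z x then [x] else []) xs) = filter (P z) xs" for z xs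
    by (induction xs) auto
  ultimately show ?thesis by simp
qed

lemma ptime_Suc [ptime_intros]: "ptime f \<Longrightarrow> ptime (\<lambda>x. Suc (f x))"
  by (rule ptime_comp[of Suc]) (rule ptime_exp[of "NodeE LeafE (Var 0)"], auto)

text \<open>Unary numbers and lists of units have the same encoding; thus a fold over such a list is
  a loop with a numeric bound.\<close>

lemma ptime_replicate_unit: "ptime f \<Longrightarrow> ptime (\<lambda>x. replicate (f x) ())"
  by (erule ptime_cong_enc) (rule enc_replicate_unit)

lemma ptime_minus_nat [ptime_intros]:
  assumes "ptime f" "ptime g"
  shows "ptime (\<lambda>x. f x - g x :: nat)"
proof -
  have pred: "ptime (\<lambda>n :: nat. n - 1)"
  proof (rule ptime_exp[of "RightE (Var 0)"])
    show "enc (n - 1) = eval_exp (RightE (Var 0)) (\<lambda>_. enc n)" for n :: nat by (cases n) auto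
  qed auto
  have "ptime (\<lambda>x. foldl (\<lambda>a _. a - 1) (f x) (replicate (g x) ()))"
    by (intro ptime_foldl_additive[where q = 0] assms ptime_replicate_unit ptime_comp[OF pred] ptime_intros) simp
  moreover have "foldl (\<lambda>a _. a - 1) m (replicate n ()) = m - n" for m n :: nat
    by (induction n arbitrary: m) auto
  ultimately show ?thesis by simp
qed

lemma ptime_eq_0 [ptime_intros]: "ptime f \<Longrightarrow> ptime (\<lambda>x. f x = (0 :: nat))"
  using ptime_eq_Nil[OF ptime_replicate_unit[of f]] by simp

lemma ptime_less [ptime_intros]: "ptime f \<Longrightarrow> ptime g \<Longrightarrow> ptime (\<lambda>x. f x < (g x :: nat))"
  using ptime_not[OF ptime_eq_0[OF ptime_minus_nat[of g f]]] by (simp add: not_le)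

lemma ptime_eq_nat [ptime_intros]: "ptime f \<Longrightarrow> ptime g \<Longrightarrow> ptime (\<lambda>x. f x = (g x :: nat))"
  by (rule ptime_cong_enc[OF ptime_conj[OF ptime_not[OF ptime_less[of f g]] ptime_not[OF ptime_less[of g f]]]])
    (auto intro!: arg_cong[where f = enc])

lemma ptime_mem [ptime_intros]:
  assumes "ptime f" "ptime g"
  shows "ptime (\<lambda>z. (f z :: nat) \<in> set (g z))"
proof -
  have "ptime (\<lambda>z. \<not> filter (\<lambda>x. x = f z) (g z) = [])"
    by (intro ptime_intros assms ptime_comp[OF assms(1)])
  then show ?thesis by (rule ptime_cong_enc) (auto simp: filter_empty_conv intro!: arg_cong[where f = enc])
qed

lemma ptime_upt [ptime_intros]:
  assumes "ptime f"
  shows "ptime (\<lambda>z. [0..<f z])"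
proof -
  let ?step = "\<lambda>a (_::unit). (Suc (fst a), fst a # snd a)"
  have eq: "foldl ?step (0, []) (replicate n ()) = (n, rev [0..<n])" for n
  proof (induction n)
    case (Suc n)
    have "replicate (Suc n) () = replicate n () @ [()]" by (simp add: replicate_append_same)
    then show ?case by (simp only: foldl_append Suc) simp
  qed auto
  have "ptime (\<lambda>n. foldl ?step (0, []) (replicate n ()))"
  \<comment> \<open>A step copies the counter, which is unbounded for an arbitrary accumulator, so
    the additive criterion fails. The bound is taken on the accumulators that do occur: pair node
    and counter give n + 1, the list at most n * (n + 1).\<close>
  proof (rule ptime_foldl[where q = "[:1, 1:] + [:0, 1:] * [:1, 1:]"])
    fix n k :: nat
    let ?j = "min k n"
    have "size (enc [0..<?j]) \<le> ?j * Suc ?j"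
      using size_enc_le[of "[0..<?j]" ?j] by simp
    also have "\<dots> \<le> n * Suc n" by (rule mult_le_mono) auto
    finally show "size (enc (foldl ?step (0, []) (take k (replicate n ())))) \<le>
      poly ([:1, 1:] + [:0, 1:] * [:1, 1:]) (size (enc n))"
      unfolding take_replicate eq by simp
  qed (intro ptime_intros ptime_replicate_unit)+
  from ptime_comp[OF ptime_rev[OF ptime_snd[OF this]] assms] show ?thesis
    by (simp add: eq)
qed

section \<open>Affine functionals and normal forms\<close>

text \<open>The list \<open>l\<close> stands for the functional \<open>\<Sum>s\<in>l. x\<^sub>s\<close>, where the index \<open>N\<close> represents the constant 1.
  Re-filtering \<open>[0..<Suc N]\<close> keeps every sum short whatever its arguments are, so that size bounds
  need no assumption on the circuit.\<close>

definition xorl :: "nat \<Rightarrow> nat list \<Rightarrow> nat list \<Rightarrow> nat list" where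
  "xorl N a b = filter (\<lambda>i. (i \<in> set a) \<noteq> (i \<in> set b)) [0..<Suc N]"

text \<open>Subsets of {0..N} in increasing enumeration, so a functional has one representation only
  and \<open>xorl\<close> is the symmetric difference.\<close>

definition canonical :: "nat \<Rightarrow> nat list \<Rightarrow> bool" where
  "canonical N l \<longleftrightarrow> l = filter (\<lambda>i. i \<in> set l) [0..<Suc N]"

primrec ev :: "nat \<Rightarrow> (nat \<Rightarrow> bool) \<Rightarrow> nat list \<Rightarrow> bool" where
  "ev N x [] = False"
| "ev N x (s # l) = ((s = N \<or> x s) \<noteq> ev N x l)"

lemma canonical_filter_upt: "canonical N (filter P [0..<Suc N])"
  unfolding canonical_def by (rule filter_cong) auto

lemma canonical_xorl [simp]: "canonical N (xorl N a b)"
  unfolding xorl_def by (rule canonical_filter_upt)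

lemma canonical_Nil [simp]: "canonical N []"
  by (simp add: canonical_def)

lemma filter_eq_upt: "q < n \<Longrightarrow> filter (\<lambda>i. i = q) [0..<n] = [q]"
  by (induction n) (auto simp: less_Suc_eq filter_empty_conv)

lemma canonical_singleton: "q \<le> N \<Longrightarrow> canonical N [q]"
  using filter_eq_upt[of q "Suc N"] by (simp add: canonical_def del: upt_Suc)

lemma canonicalE:
  assumes "canonical N l"
  obtains P where "l = filter P [0..<Suc N]"
  using assms unfolding canonical_def by blast

lemma xorl_Nil: "canonical N a \<Longrightarrow> xorl N a [] = a"
  unfolding canonical_def xorl_def by (drule sym) (simp del: upt_Suc)

lemma canonical_filter:
  assumes "canonical N l"
  shows "canonical N (filter P l)"
proof -
  obtain Q where "l = filter Q [0..<Suc N]" using assms by (rule canonicalE)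
  then show ?thesis by (simp only: filter_filter canonical_filter_upt)
qed

lemma canonical_le:
  assumes "canonical N l" "s \<in> set l"
  shows "s \<le> N"
proof -
  obtain Q where "l = filter Q [0..<Suc N]" using assms(1) by (rule canonicalE)
  then show ?thesis using assms(2) by (auto simp del: upt_Suc)
qed

lemma canonical_sorted: "canonical N l \<Longrightarrow> sorted_wrt (<) l"
  by (erule canonicalE) (simp only: sorted_wrt_filter sorted_wrt_upt)

lemma canonical_distinct: "canonical N l \<Longrightarrow> distinct l"
  using canonical_sorted strict_sorted_iff by blast

lemma set_xorl: "set (xorl N a b) = {i. i \<le> N \<and> (i \<in> set a) \<noteq> (i \<in> set b)}"
  by (auto simp: xorl_def simp del: upt_Suc)

lemma ev_filter_neq: "ev N x (filter (\<lambda>i. P i \<noteq> Q i) us) = (ev N x (filter P us) \<noteq> ev N x (filter Q us))"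
  by (induction us) auto

lemma ev_xorl: "canonical N a \<Longrightarrow> canonical N b \<Longrightarrow> ev N x (xorl N a b) = (ev N x a \<noteq> ev N x b)"
  unfolding xorl_def ev_filter_neq canonical_def by (drule sym, drule sym) (simp del: upt_Suc)

lemma ev_cong: "(\<And>s. s \<in> set l \<Longrightarrow> s \<noteq> N \<Longrightarrow> x s = y s) \<Longrightarrow> ev N x l = ev N y l"
  by (induction l) auto

lemma ev_upd_notin: "q \<notin> set l \<Longrightarrow> ev N (x(q := b)) l = ev N x l"
  by (rule ev_cong) auto

lemma ev_remove: "distinct l \<Longrightarrow> q \<noteq> N \<Longrightarrow> ev N x (filter (\<lambda>i. i \<noteq> q) l) = (ev N x l \<noteq> (q \<in> set l \<and> x q))"
  by (induction l) auto

lemma ev_upd: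
  assumes "distinct l" "q \<noteq> N"
  shows "ev N (x(q := b)) l = (ev N x (filter (\<lambda>i. i \<noteq> q) l) \<noteq> (q \<in> set l \<and> b))"
  using ev_remove[OF assms, of "x(q := b)"] ev_upd_notin[of q "filter (\<lambda>i. i \<noteq> q) l" N x b] by auto

section \<open>Phases, constraints and the invariant of the normal form\<close>

definition phase_factor :: "nat \<Rightarrow> (nat \<Rightarrow> bool) \<Rightarrow> nat list list \<Rightarrow> complex" where
  "phase_factor N x L = prod_list (map (\<lambda>l. if ev N x l then \<i> else 1) L)"

lemma phase_factor_simps [simp]:
  "phase_factor N x [] = 1" "phase_factor N x (l # L) = (if ev N x l then \<i> else 1) * phase_factor N x L"
  "phase_factor N x (L @ M) = phase_factor N x L * phase_factor N x M"
  by (simp_all add: phase_factor_def)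

lemma phase_factor_cong: "(\<And>l. l \<in> set L \<Longrightarrow> ev N x l = ev N y (h l)) \<Longrightarrow> phase_factor N x L = phase_factor N y (map h L)"
  by (induction L) auto

definition sat :: "nat \<Rightarrow> nat list list \<Rightarrow> (nat \<Rightarrow> bool) \<Rightarrow> bool" where
  "sat N F x \<longleftrightarrow> (\<forall>r<N. x r = ev N x (F ! r))"

text \<open>A row that mentions its own qubit marks a free variable: \<open>good\<close> forces it
  to be \<open>[q]\<close>, whose constraint in \<open>sat\<close> is vacuous.\<close>

definition pivots :: "nat \<Rightarrow> nat list list \<Rightarrow> nat set" where
  "pivots N F = {q. q < N \<and> q \<in> set (F ! q)}"

definition good :: "nat \<Rightarrow> nat list list \<Rightarrow> nat list list \<Rightarrow> bool" where
  "good N F L \<longleftrightarrow> length F = N \<and> (\<forall>l\<in>set F \<union> set L. canonical N l \<and> set l \<subseteq> insert N (pivots N F)) \<and>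
     (\<forall>q\<in>pivots N F. F ! q = [q])"

lemma goodD:
  assumes "good N F L"
  shows "length F = N" "l \<in> set F \<union> set L \<Longrightarrow> canonical N l"
    "l \<in> set F \<union> set L \<Longrightarrow> set l \<subseteq> insert N (pivots N F)"
    "s < N \<Longrightarrow> canonical N (F ! s)" "s < N \<Longrightarrow> set (F ! s) \<subseteq> insert N (pivots N F)"
  using assms unfolding good_def by auto

lemma good_pivot: "good N F L \<Longrightarrow> s < N \<Longrightarrow> s \<in> set (F ! s) \<Longrightarrow> F ! s = [s]"
  unfolding good_def pivots_def by blast

definition amp :: "nat \<Rightarrow> nat list list \<Rightarrow> nat list list \<Rightarrow> complex \<Rightarrow> (nat \<Rightarrow> bool) \<Rightarrow> complex" where
  "amp N F L \<alpha> x = (if sat N F x then \<alpha> * phase_factor N x L else 0)"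

text \<open>Nothing is known about the size of \<open>F ! q\<close> out of range, while running
  times must be bounded even for gates on qubits that do not exist; hence the default.\<close>

definition row_of :: "'a list list \<Rightarrow> nat \<Rightarrow> 'a list" where
  "row_of F q = (if q < length F then F ! q else [])"

definition set_row :: "nat \<Rightarrow> 'a list list \<Rightarrow> nat \<Rightarrow> 'a list \<Rightarrow> 'a list list" where
  "set_row N F q v = map (\<lambda>r. if r = q then v else row_of F r) [0..<N]"

lemma set_row_eq: "length F = N \<Longrightarrow> set_row N F q v = F[q := v]"
  by (rule nth_equalityI) (simp_all add: set_row_def row_of_def nth_list_update)

text \<open>From \<open>2 * a * b = a + b - (a + b mod 2)\<close> and \<open>-1 = 3\<close> modulo 4.\<close>

definition cz_terms :: "nat \<Rightarrow> nat list \<Rightarrow> nat list \<Rightarrow> nat list list" where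
  "cz_terms N a b = [a, b, xorl N a b, xorl N a b, xorl N a b]"

lemma phase_factor_cz_terms:
  "canonical N a \<Longrightarrow> canonical N b \<Longrightarrow> phase_factor N x (cz_terms N a b) = (if ev N x a \<and> ev N x b then -1 else 1)"
  by (simp add: cz_terms_def ev_xorl)

text \<open>If \<open>f\<close> contains \<open>q\<close>, the constraint \<open>x\<^sub>r = f(x)\<close> allows to add \<open>f + x\<^sub>r\<close> to \<open>g\<close>, which eliminates \<open>q\<close>.\<close>

definition subst_var :: "nat \<Rightarrow> nat \<Rightarrow> nat \<Rightarrow> nat list \<Rightarrow> nat list \<Rightarrow> nat list" where
  "subst_var N q r f g = (if q \<in> set g then xorl N (xorl N g f) [r] else g)"

lemma ev_subst:
  assumes "canonical N f" "canonical N g" "r < N"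
  shows "ev N x (subst_var N q r f g) = (ev N x g \<noteq> (q \<in> set g \<and> (ev N x f \<noteq> x r)))"
  using assms by (auto simp: subst_var_def ev_xorl canonical_singleton)

lemma set_subst:
  "canonical N f \<Longrightarrow> canonical N g \<Longrightarrow> r < N \<Longrightarrow> set (subst_var N q r f g) =
    (if q \<in> set g then {i. ((i \<in> set g) \<noteq> (i \<in> set f)) \<noteq> (i = r)} else set g)"
  by (auto simp: subst_var_def set_xorl dest: canonical_le)

lemma set_subst_subset: "set (subst_var N q r f g) \<subseteq> insert r (set f \<union> set g)"
  by (auto simp: subst_var_def set_xorl)

lemma subst_eliminates: "q \<in> set f \<Longrightarrow> r \<noteq> q \<Longrightarrow> q \<notin> set (subst_var N q r f g)"
  by (simp add: subst_var_def set_xorl)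

section \<open>Exchange of the pivot \<open>q\<close> for a qubit \<open>r\<close> whose row
  contains \<open>q\<close>\<close>

context
  fixes N q r :: nat and F L F' L' :: "nat list list"
  assumes good: "good N F L" and qr: "q < N" "r < N" "r \<noteq> q" and q: "q \<in> set (F ! q)" and r: "q \<in> set (F ! r)"
    and F': "F' = map (subst_var N q r (F ! r)) F" and L': "L' = map (subst_var N q r (F ! r)) L"
begin

lemma pivot_canonical: "length F = N" "l \<in> set F \<union> set L \<Longrightarrow> canonical N l" "s < N \<Longrightarrow> canonical N (F ! s)"
    "s < N \<Longrightarrow> F' ! s = subst_var N q r (F ! r) (F ! s)"
  using goodD[OF good] by (auto simp: F')

lemma pivot_row_r: "r \<notin> set (F ! r)"
proof
  assume "r \<in> set (F ! r)"
  then have "F ! r = [r]" by (rule good_pivot[OF good qr(2)])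
  then show False using r qr by auto
qed

lemma pivot_ev: "s < N \<Longrightarrow> ev N x (F' ! s) = (ev N x (F ! s) \<noteq> (q \<in> set (F ! s) \<and> (ev N x (F ! r) \<noteq> x r)))"
  using qr by (simp only: pivot_canonical ev_subst)

text \<open>The constraint at \<open>r\<close> moves to \<open>q\<close>: the vacuous row
  \<open>[q]\<close> turns into the sum of q, \<open>F ! r\<close> and r, which demands exactly that
  \<open>x r\<close> equals the old row of \<open>r\<close>, while row \<open>r\<close> becomes the
  vacuous \<open>[r]\<close>.\<close>

lemma pivot_sat: "sat N F' x \<longleftrightarrow> sat N F x"
proof
  assume "sat N F x"
  then show "sat N F' x"
    unfolding sat_def using qr(2) by (metis pivot_ev)
next
  assume *: "sat N F' x"
  have "F ! q = [q]" using good_pivot[OF good qr(1) q] .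
  then have "ev N x (F' ! q) = (x q \<noteq> (ev N x (F ! r) \<noteq> x r))"
    using pivot_ev[OF qr(1)] qr(1) by simp
  then have "ev N x (F ! r) = x r"
    using * qr(1) unfolding sat_def by metis
  then show "sat N F x"
    using * unfolding sat_def by (metis pivot_ev)
qed

lemma pivot_mem: "s < N \<Longrightarrow> i \<in> set (F' ! s) \<longleftrightarrow>
    (if q \<in> set (F ! s) then ((i \<in> set (F ! s)) \<noteq> (i \<in> set (F ! r))) \<noteq> (i = r) else i \<in> set (F ! s))"
  using qr by (simp only: pivot_canonical set_subst mem_Collect_eq split: if_split) simp

text \<open>Row \<open>q\<close> loses q by cancellation and row \<open>r\<close> becomes
  \<open>[r]\<close>. Another pivot row \<open>[s]\<close> does not contain q and stays. In the row
  of any other s nothing changes at s, because \<open>F ! r\<close> consists of pivots and the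
  constant.\<close>

lemma pivot_pivots: "pivots N F' = insert r (pivots N F - {q})"
proof -
  have iff: "s \<in> set (F' ! s) \<longleftrightarrow> s = r \<or> s \<noteq> q \<and> s \<in> set (F ! s)" if s: "s < N" for s
  proof (cases "s = r")
    case True
    then show ?thesis using r qr by (simp add: pivot_mem)
  next
    case False
    show ?thesis
    proof (cases "s \<in> set (F ! s)")
      case True
      then have "F ! s = [s]" by (rule good_pivot[OF good s])
      then show ?thesis using False r pivot_mem[OF s, of s] by (cases "s = q") simp_all
    next
      case sF: False
      then have "s \<notin> set (F ! r)" using goodD(5)[OF good qr(2)] s by (auto simp: pivots_def)
      then show ?thesis using False sF by (simp add: pivot_mem[OF s])
    qed
  qed
  show ?thesis
    unfolding pivots_def
  proof (rule Set.set_eqI)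
    show "s \<in> {p. p < N \<and> p \<in> set (F' ! p)} \<longleftrightarrow> s \<in> insert r ({p. p < N \<and> p \<in> set (F ! p)} - {q})" for s
      using qr(2) by (cases "s < N") (simp_all add: iff, blast+)
  qed
qed

lemma pivot_good: "good N F' L'"
proof -
  have sub: "set l \<subseteq> insert N (pivots N F)" if "l \<in> set F \<union> set L" for l
    using goodD(3)[OF good that] .
  have "canonical N (subst_var N q r (F ! r) l)" if "l \<in> set F \<union> set L" for l
    using pivot_canonical(2)[OF that] by (simp add: subst_var_def)
  moreover have "set (subst_var N q r (F ! r) l) \<subseteq> insert N (pivots N F')" if "l \<in> set F \<union> set L" for l
  proof
    fix i assume i: "i \<in> set (subst_var N q r (F ! r) l)"
    then have "i \<noteq> q" using subst_eliminates[OF r qr(3)] by metis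
    moreover have "i \<in> insert r (set (F ! r) \<union> set l)" using i set_subst_subset by blast
    ultimately show "i \<in> insert N (pivots N F')"
      using sub[OF that] goodD(5)[OF good qr(2)] unfolding pivot_pivots by blast
  qed
  moreover have "F' ! s = [s]" if "s \<in> pivots N F'" for s
  proof (cases "s = r")
    case True
    have "xorl N (F ! r) (F ! r) = []" by (auto simp: xorl_def filter_empty_conv)
    moreover have "xorl N [] [r] = [r]"
      using filter_eq_upt[of r "Suc N"] qr by (simp add: xorl_def del: upt_Suc)
    ultimately show ?thesis using True r qr(2) by (simp add: pivot_canonical(4) subst_var_def)
  next
    case False
    then have "s \<in> pivots N F" "s \<noteq> q" using that by (auto simp: pivot_pivots)
    then have "s < N" "s \<in> set (F ! s)" unfolding pivots_def by auto
    then have "F ! s = [s]" "s < N" by (auto intro: good_pivot[OF good])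
    with \<open>s \<noteq> q\<close> show ?thesis by (simp add: pivot_canonical(4) subst_var_def)
  qed
  moreover have "set F' \<union> set L' = subst_var N q r (F ! r) ` (set F \<union> set L)"
    unfolding F' L' by (simp only: set_map image_Un)
  moreover have "length F' = N" using pivot_canonical(1) by (simp add: F')
  ultimately show ?thesis unfolding good_def by (simp only: ball_simps) blast
qed

lemma pivot_card: "card (pivots N F') = card (pivots N F)"
proof -
  have "finite (pivots N F)" "q \<in> pivots N F" "r \<notin> pivots N F"
    using q qr pivot_row_r by (simp_all add: pivots_def)
  then show ?thesis unfolding pivot_pivots by (simp add: card_Suc_Diff1 del: card_Diff_insert card_Diff_singleton)
qed

lemma pivot_amp: "amp N F' L' \<alpha> x = amp N F L \<alpha> x"
proof -
  have "phase_factor N x L' = phase_factor N x L" if "sat N F x"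
    unfolding L'
  proof (rule phase_factor_cong[symmetric])
    fix l assume "l \<in> set L"
    then have "canonical N l" using pivot_canonical(2) by blast
    moreover have "ev N x (F ! r) = x r" using that qr(2) unfolding sat_def by blast
    ultimately show "ev N x l = ev N x (subst_var N q r (F ! r) l)"
      using pivot_canonical(3)[OF qr(2)] qr(2) by (simp only: ev_subst) simp
  qed
  then show ?thesis unfolding amp_def pivot_sat by simp
qed

lemma pivot_row_q: "q \<notin> set (F' ! q)"
proof -
  have "q \<notin> pivots N F'" unfolding pivot_pivots using qr(3) by simp
  then show ?thesis using qr(1) by (simp add: pivots_def)
qed

end

definition had_amp :: "nat \<Rightarrow> ((nat \<Rightarrow> bool) \<Rightarrow> complex) \<Rightarrow> (nat \<Rightarrow> bool) \<Rightarrow> complex" where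
  "had_amp q \<psi> x = (\<psi> (x(q := False)) + (if x q then -1 else 1) * \<psi> (x(q := True))) / sqrt 2"

lemma good_free_notin:
  assumes "good N F L" "q < N" "q \<notin> set (F ! q)" "l \<in> set F \<union> set L"
  shows "q \<notin> set l"
  using goodD(3)[OF assms(1,4)] assms(2,3) unfolding pivots_def by auto

text \<open>The constraint of row \<open>q\<close> leaves one of the two summands of
  \<open>had_amp\<close>, the one where the old bit equals \<open>F ! q\<close>. The new bit is free
  and contributes the sign (-1) to the power \<open>x q\<close> times \<open>F ! q\<close>. No
  functional mentions \<open>q\<close>, so everything else is independent of it.\<close>

lemma had_free:
  assumes good: "good N F L" and q: "q < N" "q \<notin> set (F ! q)"
  defines "F' \<equiv> F[q := [q]]" and "L' \<equiv> L @ cz_terms N [q] (F ! q)"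
  shows "good N F' L'" "pivots N F' = insert q (pivots N F)"
    "had_amp q (amp N F L \<alpha>) x = amp N F' L' (\<alpha> / sqrt 2) x"
proof -
  have len: "length F = N" using good by (simp add: good_def)
  have notin: "q \<notin> set l" if "l \<in> set F \<union> set L" for l
    using good_free_notin[OF good q that] .
  have canonical: "canonical N l" if "l \<in> set F \<union> set L" for l using goodD(2)[OF good that] .
  show pv: "pivots N F' = insert q (pivots N F)"
    using q len by (auto simp: pivots_def F'_def nth_list_update)
  have sub: "set l \<subseteq> insert N (pivots N F')" "canonical N l" if "l \<in> set F \<union> set L \<union> {[q]}" for l
    using goodD(2,3)[OF good, of l] that q unfolding pv by (auto simp: canonical_singleton)
  have Fq: "F ! q \<in> set F" using len q by auto
  have F'_sub: "set F' \<subseteq> set F \<union> {[q]}" unfolding F'_def using set_update_subset_insert by fastforce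
  have xs: "set (xorl N [q] (F ! q)) \<subseteq> insert N (pivots N F')"
    using sub[of "F ! q"] Fq by (auto simp: set_xorl pv)
  have "canonical N l \<and> set l \<subseteq> insert N (pivots N F')" if "l \<in> set F' \<union> set L'" for l
  proof -
    have "l \<in> set F \<union> set L \<union> {[q]} \<or> l = xorl N [q] (F ! q)"
      using that F'_sub Fq by (auto simp: L'_def cz_terms_def)
    then show ?thesis using sub[of l] xs by auto
  qed
  moreover have "F' ! s = [s]" if "s \<in> pivots N F'" for s
  proof (cases "s = q")
    case False
    then have "s \<in> pivots N F" using that pv by simp
    with False show ?thesis using good unfolding good_def F'_def by simp
  qed (simp add: F'_def len q)
  ultimately show "good N F' L'" unfolding good_def by (auto simp: F'_def len)
  let ?R = "\<forall>r<N. r \<noteq> q \<longrightarrow> x r = ev N x (F ! r)"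
  have ev_row: "ev N (x(q := b)) (F ! r) = ev N x (F ! r)" if "r < N" for r b
    by (rule ev_upd_notin, rule notin) (use that len in auto)
  have s1: "sat N F (x(q := b)) \<longleftrightarrow> ?R \<and> b = ev N x (F ! q)" for b
    using q unfolding sat_def by (auto simp: ev_row)
  have s2: "sat N F' x \<longleftrightarrow> ?R"
    using q len unfolding sat_def F'_def by (auto simp: nth_list_update)
  have pf: "phase_factor N (x(q := b)) L = phase_factor N x L" for b
    using phase_factor_cong[of L N "x(q := b)" x id] notin by (simp add: ev_upd_notin)
  have cz: "phase_factor N x (cz_terms N [q] (F ! q)) = (if x q \<and> ev N x (F ! q) then -1 else 1)"
    using q by (simp add: phase_factor_cz_terms canonical_singleton sub Fq)
  show "had_amp q (amp N F L \<alpha>) x = amp N F' L' (\<alpha> / sqrt 2) x"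
    unfolding had_amp_def amp_def s1 s2 pf L'_def phase_factor_simps cz by auto
qed

text \<open>The total phase as a function of \<open>x\<^sub>q\<close>: each of the \<open>c\<close> functionals containing \<open>q\<close> changes
  from \<open>m\<close> to \<open>1 - m\<close>, hence the phase by the factor \<open>\<i> ^ c * (-1) ^ \<Sum>m\<close>.\<close>

lemma phase_factor_upd:
  assumes canonical: "\<And>l. l \<in> set L \<Longrightarrow> canonical N l" and q: "q < N"
  shows "phase_factor N (x(q := False)) L = phase_factor N x (map (filter (\<lambda>i. i \<noteq> q)) L)" (is ?false)
    and "phase_factor N (x(q := True)) L = phase_factor N x (map (filter (\<lambda>i. i \<noteq> q)) L) * \<i> ^ length (filter (\<lambda>l. q \<in> set l) L) *
      (if odd (length (filter (\<lambda>l. q \<in> set l \<and> ev N x (filter (\<lambda>i. i \<noteq> q) l)) L)) then -1 else 1)" (is ?true)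
proof -
  have "?false \<and> ?true"
    using canonical
  proof (induction L)
    case (Cons l L)
    have "canonical N l" using Cons.prems by simp
    then have ev: "ev N (x(q := b)) l = (ev N x (filter (\<lambda>i. i \<noteq> q) l) \<noteq> (q \<in> set l \<and> b))" for b
      using q by (intro ev_upd canonical_distinct) auto
    show ?case
      unfolding list.map phase_factor_simps ev
      by (subst Cons.IH[THEN conjunct1], use Cons.prems in simp,
          subst Cons.IH[THEN conjunct2], use Cons.prems in simp) simp
  qed (simp add: phase_factor_def)
  then show ?false ?true by blast+
qed

definition xor_all :: "nat \<Rightarrow> nat list list \<Rightarrow> nat list" where
  "xor_all N U = foldl (xorl N) [] U"

lemma xor_all:
  assumes "\<And>l. l \<in> set U \<Longrightarrow> canonical N l"
  shows "canonical N (xor_all N U)" "ev N x (xor_all N U) = odd (length (filter (ev N x) U))"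
    "set (xor_all N U) \<subseteq> \<Union> (set ` set U)"
proof -
  have "canonical N (foldl (xorl N) a U) \<and> ev N x (foldl (xorl N) a U) = (ev N x a \<noteq> odd (length (filter (ev N x) U))) \<and>
    set (foldl (xorl N) a U) \<subseteq> set a \<union> \<Union> (set ` set U)" if "canonical N a" for a
    using that assms
  proof (induction U arbitrary: a)
    case (Cons l U)
    have l: "canonical N l" by (rule Cons.prems) simp
    show ?case
      using Cons.IH[of "xorl N a l"] Cons.prems by (auto simp: ev_xorl l set_xorl)
  qed auto
  from this[of "[]"] show "canonical N (xor_all N U)" "ev N x (xor_all N U) = odd (length (filter (ev N x) U))"
    "set (xor_all N U) \<subseteq> \<Union> (set ` set U)"
    by (auto simp: xor_all_def)
qed

section \<open>Hadamard gates on normal forms\<close>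

text \<open>The constraints leave the pivots free, so they have two to the number of pivots
  solutions on N bits, and the prescribed modulus of \<alpha> is the normalisation of the
  state.\<close>

definition represents :: "nat \<Rightarrow> nat list list \<times> nat list list \<Rightarrow> ((nat \<Rightarrow> bool) \<Rightarrow> complex) \<Rightarrow> bool" where
  "represents N st \<psi> \<longleftrightarrow> good N (fst st) (snd st) \<and>
     (\<exists>\<alpha>. cmod \<alpha> = (1 / sqrt 2) ^ card (pivots N (fst st)) \<and> \<psi> = amp N (fst st) (snd st) \<alpha>)"

definition swap_pivot :: "nat \<Rightarrow> nat \<Rightarrow> nat \<Rightarrow> nat list list \<times> nat list list \<Rightarrow> nat list list \<times> nat list list" where
  "swap_pivot N q r st = (map (subst_var N q r (row_of (fst st) r)) (fst st), map (subst_var N q r (row_of (fst st) r)) (snd st))"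

text \<open>\<open>xorl N [q] []\<close> is \<open>[q]\<close> for a valid qubit; it stays short
  even when \<open>q\<close> exceeds \<open>N\<close>, as the size bounds require.\<close>

definition had_free_step :: "nat \<Rightarrow> nat \<Rightarrow> nat list list \<times> nat list list \<Rightarrow> nat list list \<times> nat list list" where
  "had_free_step N q st = (set_row N (fst st) q (xorl N [q] []), snd st @ cz_terms N (xorl N [q] []) (row_of (fst st) q))"

definition had_slope :: "nat \<Rightarrow> nat \<Rightarrow> nat list list \<Rightarrow> nat list" where
  "had_slope N q L = xor_all N (map (filter (\<lambda>i. i \<noteq> q)) (filter (\<lambda>l. q \<in> set l) L))"

definition had_count :: "nat \<Rightarrow> nat list list \<Rightarrow> nat" where
  "had_count q L = length (filter (\<lambda>l. q \<in> set l) L) mod 4"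

text \<open>Let e be the sum of \<open>x q\<close> and m; the gate yields (1 + (-1)^e * \<i>^c) /
  sqrt 2. For odd c the ratio of the values at e = 1 and e = 0 is (1 - \<i>^c) / (1 + \<i>^c) =
  \<i>^(4 - c), so \<open>4 - c\<close> copies of e reproduce it. For even c the value vanishes
  unless e = c/2; row \<open>q\<close> becomes m or its negation and \<open>q\<close> ceases to be a
  pivot.\<close>

definition had_pivot_step :: "nat \<Rightarrow> nat \<Rightarrow> nat list list \<times> nat list list \<Rightarrow> nat list list \<times> nat list list" where
  "had_pivot_step N q st =
    (let F = fst st; L = snd st; c = had_count q L; m = had_slope N q L; L0 = map (filter (\<lambda>i. i \<noteq> q)) L in
     if c = 0 then (set_row N F q m, L0)
     else if c = 2 then (set_row N F q (xorl N m [N]), L0)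
     else (F, L0 @ replicate (4 - c) (xorl N m [q])))"

definition pivot_rows :: "nat \<Rightarrow> nat \<Rightarrow> nat list list \<Rightarrow> nat list" where
  "pivot_rows N q F = filter (\<lambda>r. r \<noteq> q \<and> q \<in> set (row_of F r)) [0..<N]"

text \<open>With the default 0 the head of a list is the plain projection \<open>left\<close> on
  encodings.\<close>

fun hd0 :: "nat list \<Rightarrow> nat" where
  "hd0 [] = 0"
| "hd0 (x # xs) = x"

definition had_step :: "nat \<Rightarrow> nat \<Rightarrow> nat list list \<times> nat list list \<Rightarrow> nat list list \<times> nat list list" where
  "had_step N q st =
    (if q \<in> set (row_of (fst st) q) then
       if pivot_rows N q (fst st) = [] then had_pivot_step N q st
       else had_free_step N q (swap_pivot N q (hd0 (pivot_rows N q (fst st))) st)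
     else had_free_step N q st)"

lemma finite_pivots: "finite (pivots N F)"
  by (simp add: pivots_def)

lemma represents_swap_pivot:
  assumes "represents N st \<psi>" "q < N" "r < N" "r \<noteq> q" "q \<in> set (row_of (fst st) q)" "q \<in> set (row_of (fst st) r)"
  shows "represents N (swap_pivot N q r st) \<psi>" "q \<notin> set (fst (swap_pivot N q r st) ! q)"
proof -
  obtain F L where st: "st = (F, L)" by force
  have good: "good N F L" using assms(1) by (simp add: represents_def st)
  have row: "row_of F s = F ! s" if "s < N" for s using goodD(1)[OF good] that by (simp add: row_of_def)
  note q = assms(5)[unfolded st fst_conv row[OF assms(2)]]
  note r = assms(6)[unfolded st fst_conv row[OF assms(3)]]
  have eq: "swap_pivot N q r st = (map (subst_var N q r (F ! r)) F, map (subst_var N q r (F ! r)) L)"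
    by (simp add: swap_pivot_def st row[OF assms(3)])
  note * = good assms(2-4) q r refl refl
  show "represents N (swap_pivot N q r st) \<psi>"
    using assms(1)[unfolded represents_def st] pivot_good[OF *] pivot_card[OF *] pivot_amp[OF *]
    unfolding represents_def eq fst_conv snd_conv by (simp add: fun_eq_iff)
  show "q \<notin> set (fst (swap_pivot N q r st) ! q)"
    unfolding eq fst_conv by (rule pivot_row_q[OF *])
qed

lemma represents_had_free:
  assumes "represents N st \<psi>" "q < N" "q \<notin> set (fst st ! q)"
  shows "represents N (had_free_step N q st) (had_amp q \<psi>)"
proof -
  obtain F L where st: "st = (F, L)" by force
  from assms(1) obtain \<alpha> where good: "good N F L" and \<alpha>: "cmod \<alpha> = (1 / sqrt 2) ^ card (pivots N F)"
    and \<psi>: "\<psi> = amp N F L \<alpha>" by (auto simp: represents_def st)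
  have q: "q \<notin> set (F ! q)" using assms(3) by (simp add: st)
  have len: "length F = N" using goodD(1)[OF good] .
  have eq: "had_free_step N q st = (F[q := [q]], L @ cz_terms N [q] (F ! q))"
    using xorl_Nil[OF canonical_singleton[of q N]] assms(2) len
    by (simp add: had_free_step_def st set_row_eq row_of_def)
  have "finite (pivots N F)" "q \<notin> pivots N F" using q by (auto simp: pivots_def)
  then have "cmod (\<alpha> / sqrt 2) = (1 / sqrt 2) ^ card (insert q (pivots N F))"
    using \<alpha> by (simp add: norm_divide power_divide)
  then show ?thesis
    using had_free[OF good assms(2) q] unfolding represents_def eq \<psi> fst_conv snd_conv
    by (intro conjI exI[of _ "\<alpha> / sqrt 2"]) auto
qed

lemma had_slope:
  assumes canonical: "\<And>l. l \<in> set L \<Longrightarrow> canonical N l" and sub: "\<And>l. l \<in> set L \<Longrightarrow> set l \<subseteq> A"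
  shows "canonical N (had_slope N q L)" "set (had_slope N q L) \<subseteq> A - {q}"
    "ev N x (had_slope N q L) = odd (length (filter (\<lambda>l. q \<in> set l \<and> ev N x (filter (\<lambda>i. i \<noteq> q) l)) L))"
proof -
  let ?U = "map (filter (\<lambda>i. i \<noteq> q)) (filter (\<lambda>l. q \<in> set l) L)"
  have *: "canonical N l" if "l \<in> set ?U" for l using that canonical by (auto intro: canonical_filter)
  show "canonical N (had_slope N q L)" unfolding had_slope_def by (rule xor_all(1)[OF *])
  show "set (had_slope N q L) \<subseteq> A - {q}"
    using xor_all(3)[OF *] sub unfolding had_slope_def by fastforce
  show "ev N x (had_slope N q L) = odd (length (filter (\<lambda>l. q \<in> set l \<and> ev N x (filter (\<lambda>i. i \<noteq> q) l)) L))"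
  proof -
    have "ev N x (xor_all N ?U) = odd (length (filter (ev N x) ?U))" by (rule xor_all(2)) (rule *)
    then show ?thesis unfolding had_slope_def by (simp add: filter_map o_def)
  qed
qed

lemma i_power_mod4: "\<i> ^ n = \<i> ^ (n mod 4)"
proof -
  have "\<i> ^ n = (\<i> ^ 4) ^ (n div 4) * \<i> ^ (n mod 4)"
    unfolding power_mult[symmetric] power_add[symmetric] by simp
  then show ?thesis by simp
qed

lemma phase_factor_replicate: "phase_factor N x (replicate k l) = (if ev N x l then \<i> else 1) ^ k"
  by (simp add: phase_factor_def)

lemma represents_had_pivot:
  assumes "represents N st \<psi>" "q < N" "q \<in> set (row_of (fst st) q)" "pivot_rows N q (fst st) = []"
  shows "represents N (had_pivot_step N q st) (had_amp q \<psi>)"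
proof -
  obtain F L where st: "st = (F, L)" by force
  from assms(1) obtain \<alpha> where good: "good N F L" and \<alpha>: "cmod \<alpha> = (1 / sqrt 2) ^ card (pivots N F)"
    and \<psi>: "\<psi> = amp N F L \<alpha>" by (auto simp: represents_def st)
  have len: "length F = N" using goodD(1)[OF good] .
  have qF: "q \<in> set (F ! q)" using assms(2,3) by (simp add: st row_of_def len)
  have Fq: "F ! q = [q]" by (rule good_pivot[OF good assms(2) qF])
  have notin: "q \<notin> set (F ! r)" if "r < N" "r \<noteq> q" for r
  proof -
    have "r \<notin> set (pivot_rows N q F)" using assms(4) by (simp add: st)
    then show ?thesis using that by (simp add: pivot_rows_def row_of_def len)
  qed
  have qp: "q \<in> pivots N F" using qF assms(2) by (simp add: pivots_def)
  let ?del = "filter (\<lambda>i. i \<noteq> q)"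
  define L0 where "L0 = map ?del L"
  define m where "m = had_slope N q L"
  define c where "c = had_count q L"
  have nrmL: "canonical N l" and subL: "set l \<subseteq> insert N (pivots N F)" if "l \<in> set L" for l
    using goodD(2,3)[OF good] that by auto
  have m: "canonical N m" "set m \<subseteq> insert N (pivots N F) - {q}"
    unfolding m_def by (rule had_slope[OF nrmL subL]; assumption)+
  have ev_m: "ev N x m = odd (length (filter (\<lambda>l. q \<in> set l \<and> ev N x (?del l)) L))" for x
    unfolding m_def by (rule had_slope(3)[OF nrmL subL])
  have L0: "canonical N l" "set l \<subseteq> insert N (pivots N F) - {q}" if "l \<in> set L0" for l
  proof -
    obtain k where "k \<in> set L" "l = ?del k" using \<open>l \<in> set L0\<close> by (auto simp: L0_def)
    then show "canonical N l" "set l \<subseteq> insert N (pivots N F) - {q}" using nrmL[of k] subL[of k] by (auto intro: canonical_filter)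
  qed
  define R where "R x \<longleftrightarrow> (\<forall>r<N. r \<noteq> q \<longrightarrow> x r = ev N x (F ! r))" for x
  \<comment> \<open>Row \<open>q\<close> is \<open>[q]\<close> and no other row mentions
    \<open>q\<close>, so both values of \<open>x q\<close> satisfy the same constraints and both
    summands of \<open>had_amp\<close> survive.\<close>
  have sat_upd: "sat N F (x(q := b)) \<longleftrightarrow> R x" for x b
  proof -
    have "(x(q := b)) r = ev N (x(q := b)) (F ! r) \<longleftrightarrow> r = q \<or> x r = ev N x (F ! r)" if "r < N" for r
      using ev_upd_notin[OF notin[OF that], of N x b] Fq assms(2) by (cases "r = q") auto
    then show ?thesis unfolding sat_def R_def by blast
  qed
  have "length (filter (\<lambda>l. q \<in> set l) L) mod 4 = c" by (simp add: c_def had_count_def)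
  then have ic: "\<i> ^ length (filter (\<lambda>l. q \<in> set l) L) = \<i> ^ c" by (metis i_power_mod4)
  have phase_factor_q: "phase_factor N (x(q := False)) L = phase_factor N x L0"
    "phase_factor N (x(q := True)) L = phase_factor N x L0 * \<i> ^ c * (if ev N x m then -1 else 1)" for x
    unfolding L0_def ic[symmetric] ev_m by (rule phase_factor_upd; use nrmL assms(2) in blast)+
  have had: "had_amp q \<psi> x = (if R x then \<alpha> * phase_factor N x L0 * ((1 + (if x q \<noteq> ev N x m then -1 else 1) * \<i> ^ c) / sqrt 2) else 0)" for x
    unfolding \<psi> had_amp_def amp_def sat_upd phase_factor_q
    by (simp add: field_simps)
  have step: "had_pivot_step N q st = (if c = 0 then (F[q := m], L0) else if c = 2 then (F[q := xorl N m [N]], L0)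
     else (F, L0 @ replicate (4 - c) (xorl N m [q])))"
    by (simp add: had_pivot_step_def Let_def st c_def m_def L0_def set_row_eq[OF len])
  have satF: "sat N F x \<longleftrightarrow> R x" for x using sat_upd[of x "x q"] by simp
  have ev_m': "ev N x (xorl N m [q]) = (ev N x m \<noteq> x q)" for x
    using m(1) assms(2) by (simp add: ev_xorl canonical_singleton)
  have "set (xorl N m [q]) \<subseteq> insert N (pivots N F)" using m(2) qp by (auto simp: set_xorl)
  then have good_odd: "good N F (L0 @ replicate k (xorl N m [q]))" for k
    using good L0 unfolding good_def by auto
  have "c < 4" by (simp add: c_def had_count_def)
  then have "c = 0 \<or> c = 1 \<or> c = 2 \<or> c = 3" by arith
  then consider "even c" | "c = 1" | "c = 3" by auto
  then show ?thesis
  proof cases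
    case 1
    with \<open>c < 4\<close> have c: "c = 0 \<or> c = 2" by (auto elim!: evenE)
    define w where "w = (if c = 0 then m else xorl N m [N])"
    have w: "canonical N w" "set w \<subseteq> insert N (pivots N F) - {q}"
      using m assms(2) by (auto simp: w_def set_xorl)
    have ev_w: "ev N x w = (ev N x m \<noteq> (c = 2))" for x
      using m(1) c by (auto simp: w_def ev_xorl canonical_singleton)
    have eq: "had_pivot_step N q st = (F[q := w], L0)" unfolding step w_def using c by auto
    have pv: "pivots N (F[q := w]) = pivots N F - {q}"
    proof -
      have "q \<notin> set w" using w(2) by blast
      then show ?thesis using assms(2) by (auto simp: pivots_def nth_list_update len split: if_splits)
    qed
    have "canonical N l \<and> set l \<subseteq> insert N (pivots N F - {q})" if "l \<in> set (F[q := w]) \<union> set L0" for l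
    proof (cases "l \<in> set L0 \<or> l = w")
      case False
      then have "l \<in> set (F[q := w])" using that by blast
      then obtain r where "r < N" "l = F[q := w] ! r" using len by (metis in_set_conv_nth length_list_update)
      moreover have "r \<noteq> q" using False calculation assms(2) len by auto
      ultimately have "r < N" "r \<noteq> q" "l = F ! r" by simp_all
      then show ?thesis using goodD(4,5)[OF good, of r] notin[of r] by auto
    qed (use L0 w assms(2) in auto)
    moreover have "F[q := w] ! s = [s]" if "s \<in> pivots N F - {q}" for s
      using that good unfolding good_def by auto
    ultimately have g: "good N (F[q := w]) L0" unfolding good_def pv by (simp add: len)
    have row_w: "F[q := w] ! r = (if r = q then w else F ! r)" if "r < N" for r
      using that len by (simp add: nth_list_update)
    have sat_w: "sat N (F[q := w]) x \<longleftrightarrow> R x \<and> x q = ev N x w" for x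
      unfolding sat_def R_def using row_w assms(2) by metis
    \<comment> \<open>Where the sum over \<open>x q\<close> does not vanish it is 2 / sqrt 2,
      exactly the factor by which the normalisation changes when a pivot is lost.\<close>
    have "2 / complex_of_real (sqrt 2) = sqrt 2"
      by (metis of_real_divide of_real_numeral real_div_sqrt zero_le_numeral)
    then have key: "(1 + (if x q \<noteq> ev N x m then -1 else 1) * \<i> ^ c) / sqrt 2 = (if x q = ev N x w then complex_of_real (sqrt 2) else 0)" for x
      using c by (cases "x q"; cases "ev N x m") (auto simp: ev_w)
    have "had_amp q \<psi> x = amp N (F[q := w]) L0 (\<alpha> * sqrt 2) x" for x
      unfolding amp_def had sat_w key by simp
    then have "had_amp q \<psi> = amp N (F[q := w]) L0 (\<alpha> * sqrt 2)" by blast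
    moreover have "card (pivots N F) = Suc (card (pivots N F - {q}))"
      using card_Suc_Diff1[of "pivots N F" q] qp finite_pivots by metis
    then have "cmod (\<alpha> * sqrt 2) = (1 / sqrt 2) ^ card (pivots N F - {q})"
      using \<alpha> by (simp add: norm_mult)
    ultimately show ?thesis unfolding represents_def eq fst_conv snd_conv pv using g by blast
  next
    case 2
    then have eq: "had_pivot_step N q st = (F, L0 @ replicate 3 (xorl N m [q]))" by (simp add: step)
    \<comment> \<open>The scalar (1 + \<i>) / sqrt 2 is the value at e = 0; the three copies turn it
      into (1 - \<i>) / sqrt 2 at e = 1.\<close>
    have "had_amp q \<psi> = amp N F (L0 @ replicate 3 (xorl N m [q])) (\<alpha> * ((1 + \<i>) / sqrt 2))"
      unfolding amp_def had satF phase_factor_simps phase_factor_replicate ev_m' using 2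
      by (auto simp: fun_eq_iff power3_eq_cube field_simps)
    moreover have "cmod (1 + \<i>) = sqrt 2" by (simp add: cmod_def)
    then have "cmod (\<alpha> * ((1 + \<i>) / sqrt 2)) = (1 / sqrt 2) ^ card (pivots N F)"
      using \<alpha> by (simp add: norm_mult norm_divide)
    ultimately show ?thesis unfolding represents_def eq using good_odd[of 3] by auto
  next
    case 3
    then have eq: "had_pivot_step N q st = (F, L0 @ replicate 1 (xorl N m [q]))" by (simp add: step)
    have "had_amp q \<psi> = amp N F (L0 @ replicate 1 (xorl N m [q])) (\<alpha> * ((1 - \<i>) / sqrt 2))"
      unfolding amp_def had satF phase_factor_simps phase_factor_replicate ev_m' using 3
      by (auto simp: fun_eq_iff power3_eq_cube field_simps)
    moreover have "cmod (1 - \<i>) = sqrt 2" by (simp add: cmod_def)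
    then have "cmod (\<alpha> * ((1 - \<i>) / sqrt 2)) = (1 / sqrt 2) ^ card (pivots N F)"
      using \<alpha> by (simp add: norm_mult norm_divide)
    ultimately show ?thesis unfolding represents_def eq using good_odd[of 1] by auto
  qed
qed

section \<open>Circuits acting on amplitudes\<close>

lemma represents_had_step:
  assumes "represents N st \<psi>" "q < N"
  shows "represents N (had_step N q st) (had_amp q \<psi>)"
proof -
  have len: "length (fst st) = N" using assms(1) goodD(1) by (auto simp: represents_def)
  have row: "row_of (fst st) q = fst st ! q" using assms(2) len by (simp add: row_of_def)
  show ?thesis
  proof (cases "q \<in> set (row_of (fst st) q)")
    case True
    show ?thesis
    proof (cases "pivot_rows N q (fst st)")
      case Nil
      then show ?thesis using represents_had_pivot[OF assms True] True by (simp add: had_step_def)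
    next
      case (Cons r rs)
      then have "r \<in> set (pivot_rows N q (fst st))" by simp
      then have r: "r < N" "r \<noteq> q" "q \<in> set (row_of (fst st) r)" by (simp_all add: pivot_rows_def)
      note sw = represents_swap_pivot[OF assms r(1,2) True r(3)]
      have "had_step N q st = had_free_step N q (swap_pivot N q r st)"
        using True Cons by (simp add: had_step_def)
      then show ?thesis using represents_had_free[OF sw(1) assms(2) sw(2)] by simp
    qed
  next
    case False
    then show ?thesis using represents_had_free[OF assms] row by (simp add: had_step_def)
  qed
qed

text \<open>The new amplitude at \<open>x\<close> is the old one at the preimage of
  \<open>x\<close>. NOT and CNOT are involutions, so preimage and image agree.\<close>

fun act :: "gate \<Rightarrow> ((nat \<Rightarrow> bool) \<Rightarrow> complex) \<Rightarrow> (nat \<Rightarrow> bool) \<Rightarrow> complex" where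
  "act (HAD q) \<psi> x = had_amp q \<psi> x"
| "act (PHASE q) \<psi> x = (if x q then \<i> else 1) * \<psi> x"
| "act (NOT q) \<psi> x = \<psi> (x(q := \<not> x q))"
| "act (CNOT a b) \<psi> x = \<psi> (if x a then x(b := \<not> x b) else x)"
| "act (CPHASE a b) \<psi> x = (if x a \<and> x b then -1 else 1) * \<psi> x"

text \<open>Amplitudes are functions of assignments to all natural numbers, which spares index
  arithmetic in the normal form; the numbering of basis states enters only here.\<close>

definition vec_of :: "nat \<Rightarrow> ((nat \<Rightarrow> bool) \<Rightarrow> complex) \<Rightarrow> complex vec" where
  "vec_of N \<psi> = vec (2 ^ N) (\<lambda>z. \<psi> (bit z))"

lemma bit_upd_nat:
  "bit (flip_bit q (z::nat)) = (bit z)(q := \<not> bit z q)"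
  "bit (unset_bit q (z::nat)) = (bit z)(q := False)"
  "bit (set_bit q (z::nat)) = (bit z)(q := True)"
  by (auto simp: fun_eq_iff bit_simps)

lemma nat_eq_iff_bit: "i = j \<longleftrightarrow> bit i = bit j" for i j :: nat
  by (auto intro: bit_eqI)

text \<open>These are the two columns in which row \<open>i\<close> of a Hadamard gate can be
  nonzero.\<close>

lemma unset_bit_eq_iff: "unset_bit q i = unset_bit q j \<longleftrightarrow> j = unset_bit q i \<or> j = set_bit q i" for i j :: nat
proof
  assume *: "unset_bit q i = unset_bit q j"
  have "set_bit q i = set_bit q (unset_bit q i)" "set_bit q j = set_bit q (unset_bit q j)"
    unfolding nat_eq_iff_bit bit_upd_nat by simp_all
  moreover have "j = (if bit j q then set_bit q j else unset_bit q j)"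
    unfolding nat_eq_iff_bit by (simp add: bit_upd_nat fun_upd_idem)
  ultimately show "j = unset_bit q i \<or> j = set_bit q i"
    using * by metis
next
  assume "j = unset_bit q i \<or> j = set_bit q i"
  moreover have "unset_bit q (unset_bit q i) = unset_bit q i" "unset_bit q (set_bit q i) = unset_bit q i"
    unfolding nat_eq_iff_bit bit_upd_nat by simp_all
  ultimately show "unset_bit q i = unset_bit q j" by metis
qed

lemma flip_bit_flip_bit: "flip_bit q (flip_bit q i) = i" for i :: nat
  unfolding nat_eq_iff_bit bit_upd_nat by simp

lemma flip_bit_eq_iff: "i = flip_bit q j \<longleftrightarrow> j = flip_bit q i" for i j :: nat
  using flip_bit_flip_bit by metis

lemma cnot_eq_iff:
  fixes i j :: nat
  assumes "a \<noteq> b"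
  shows "i = (if bit j a then flip_bit b j else j) \<longleftrightarrow> j = (if bit i a then flip_bit b i else i)"
proof -
  have "bit (flip_bit b k) a = bit k a" for k :: nat
    using assms by (simp add: bit_upd_nat)
  then show ?thesis using flip_bit_flip_bit by metis
qed

lemma upd_bit_less:
  fixes z :: nat
  assumes "q < N" "z < 2 ^ N"
  shows "flip_bit q z < 2 ^ N" "unset_bit q z < 2 ^ N" "set_bit q z < 2 ^ N"
  using assms unfolding take_bit_nat_eq_self_iff[symmetric]
  by (simp_all add: take_bit_flip_bit_eq take_bit_unset_bit_eq take_bit_set_bit_eq)

lemma hadamard_entry:
  "hadamard $$ (0, 0) = 1 / sqrt 2" "hadamard $$ (0, Suc 0) = 1 / sqrt 2"
  "hadamard $$ (Suc 0, 0) = 1 / sqrt 2" "hadamard $$ (Suc 0, Suc 0) = - 1 / sqrt 2"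
  by (simp_all add: hadamard_def mat_of_rows_list_def)

lemma gate_mat_vec_of:
  assumes "gate_on N g"
  shows "gate_mat N g *\<^sub>v vec_of N \<psi> = vec_of N (act g \<psi>)"
proof (rule eq_vecI)
  fix i assume "i < dim_vec (vec_of N (act g \<psi>))"
  then have i: "i < 2 ^ N" by (simp add: vec_of_def)
  have "(gate_mat N g *\<^sub>v vec_of N \<psi>) $ i = (\<Sum>j<2 ^ N. gate_entry g i j * \<psi> (bit j))"
    using i by (simp add: gate_mat_def vec_of_def scalar_prod_def atLeast0LessThan)
  also have "\<dots> = act g \<psi> (bit i)"
  proof (cases g)
    case (HAD q)
    then have q: "q < N" using assms by simp
    have ne: "unset_bit q i \<noteq> set_bit q i"
      unfolding nat_eq_iff_bit bit_upd_nat by (metis fun_upd_same)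
    have eq: "unset_bit q (unset_bit q i) = unset_bit q i" "unset_bit q (set_bit q i) = unset_bit q i"
      using unset_bit_eq_iff by metis+
    have "(\<Sum>j<2 ^ N. gate_entry g i j * \<psi> (bit j)) = (\<Sum>j\<in>{unset_bit q i, set_bit q i}. gate_entry g i j * \<psi> (bit j))"
      using upd_bit_less[OF q i] by (intro sum.mono_neutral_right) (auto simp: HAD unset_bit_eq_iff)
    also have "\<dots> = act g \<psi> (bit i)"
      using ne by (simp add: HAD eq hadamard_entry had_amp_def bit_upd_nat field_simps)
    finally show ?thesis .
  next
    case (PHASE q)
    then show ?thesis using i by (simp add: if_distrib[of "\<lambda>c. c * _"] cong: if_cong)
  next
    case (NOT q)
    then have "q < N" using assms by simp
    then have "flip_bit q i < 2 ^ N" using i by (rule upd_bit_less)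
    then show ?thesis
      by (simp add: NOT flip_bit_eq_iff[of i] if_distrib[of "\<lambda>c. c * _"] bit_upd_nat cong: if_cong)
  next
    case (CNOT a b)
    then have ab: "a < N" "b < N" "a \<noteq> b" using assms by simp_all
    let ?f = "\<lambda>j :: nat. if bit j a then flip_bit b j else j"
    have "?f i < 2 ^ N" using upd_bit_less(1)[OF ab(2) i] i by simp
    then have "(\<Sum>j<2 ^ N. if j = ?f i then \<psi> (bit j) else 0) = \<psi> (bit (?f i))"
      by (subst sum.delta) simp_all
    moreover have "gate_entry g i j * \<psi> (bit j) = (if j = ?f i then \<psi> (bit j) else 0)" for j
      unfolding CNOT gate_entry.simps cnot_eq_iff[OF ab(3)] by simp
    ultimately show ?thesis unfolding CNOT by (simp add: bit_upd_nat)
  next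
    case (CPHASE a b)
    then show ?thesis using i by (simp add: if_distrib[of "\<lambda>c. c * _"] cong: if_cong)
  qed
  finally show "(gate_mat N g *\<^sub>v vec_of N \<psi>) $ i = vec_of N (act g \<psi>) $ i"
    using i by (simp add: vec_of_def)
qed (simp add: gate_mat_def vec_of_def)

lemma apply_circuit_vec_of:
  "clifford_circuit N gs \<Longrightarrow> apply_circuit N gs (vec_of N \<psi>) = vec_of N (fold act gs \<psi>)"
  unfolding clifford_circuit_def apply_circuit_def
  by (induction gs arbitrary: \<psi>) (simp_all add: gate_mat_vec_of)

definition zero_amp :: "nat \<Rightarrow> (nat \<Rightarrow> bool) \<Rightarrow> complex" where
  "zero_amp N x = (if \<forall>r<N. \<not> x r then 1 else 0)"

lemma zero_state_vec_of: "zero_state N = vec_of N (zero_amp N)"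
proof (rule eq_vecI)
  fix z assume "z < dim_vec (vec_of N (zero_amp N))"
  then have z: "z < 2 ^ N" by (simp add: vec_of_def)
  then have z': "take_bit N z = z" by (simp add: take_bit_nat_eq_self)
  have "z = 0" if "\<forall>r<N. \<not> bit z r"
  proof (rule bit_eqI)
    fix n
    have "bit z n \<longleftrightarrow> n < N \<and> bit z n" using bit_take_bit_iff[of N z n] unfolding z' .
    then show "bit z n = bit 0 n" using that by simp blast
  qed
  moreover have "\<not> bit (0 :: nat) r" for r by simp
  ultimately have "(\<forall>r<N. \<not> bit z r) \<longleftrightarrow> z = 0" by blast
  then show "zero_state N $ z = vec_of N (zero_amp N) $ z"
    using z by (simp add: zero_state_def vec_of_def zero_amp_def unit_vec_def)
qed (simp add: zero_state_def vec_of_def)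

text \<open>The square of PHASE is Z, and conjugation by Hadamard turns Z into NOT. CPHASE
  conjugated on the target is CNOT in the same way.\<close>

fun to_hpcz :: "gate \<Rightarrow> gate list" where
  "to_hpcz (NOT q) = [HAD q, PHASE q, PHASE q, HAD q]"
| "to_hpcz (CNOT a b) = [HAD b, CPHASE a b, HAD b]"
| "to_hpcz g = [g]"

text \<open>A diagonal operator between two Hadamard gates. \<open>u\<close> and \<open>v\<close>
  are its factors on the two values of qubit \<open>q\<close>; they may depend on the assignment, as
  CPHASE requires. Where they are 1 and -1 the result is a flip of \<open>q\<close>, where both are
  1 the identity.\<close>

lemma had_amp_had_amp:
  assumes "\<And>x. \<chi> (x(q := False)) = u x * had_amp q \<psi> (x(q := False))"
    and "\<And>x. \<chi> (x(q := True)) = v x * had_amp q \<psi> (x(q := True))"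
  shows "had_amp q \<chi> x = (u x * (\<psi> (x(q := False)) + \<psi> (x(q := True))) +
    (if x q then -1 else 1) * v x * (\<psi> (x(q := False)) - \<psi> (x(q := True)))) / 2"
proof -
  have s: "complex_of_real (sqrt 2) * complex_of_real (sqrt 2) = 2"
    by (simp flip: of_real_mult)
  have "(a / complex_of_real (sqrt 2)) / complex_of_real (sqrt 2) = a / 2" for a
    unfolding divide_divide_eq_left s ..
  then have div: "(c * (a / complex_of_real (sqrt 2)) + e * (d * (b / complex_of_real (sqrt 2)))) / complex_of_real (sqrt 2)
      = (c * a + e * d * b) / 2" for a b c d e
    by (metis (no_types, lifting) add_divide_distrib mult.assoc times_divide_eq_right)
  have "had_amp q \<psi> (x(q := False)) = (\<psi> (x(q := False)) + \<psi> (x(q := True))) / sqrt 2"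
    "had_amp q \<psi> (x(q := True)) = (\<psi> (x(q := False)) - \<psi> (x(q := True))) / sqrt 2"
    by (simp_all add: had_amp_def)
  then show ?thesis
    unfolding had_amp_def[of q \<chi>] assms by (simp only: div)
qed

lemma fold_act_to_hpcz:
  assumes "gate_on N g"
  shows "fold act (to_hpcz g) \<psi> = act g \<psi>"
proof (cases g)
  case (NOT q)
  have "had_amp q (act (PHASE q) (act (PHASE q) (had_amp q \<psi>))) x = \<psi> (x(q := \<not> x q))" for x
    by (subst had_amp_had_amp[where \<psi> = \<psi> and u = "\<lambda>_. 1" and v = "\<lambda>_. -1"]) simp_all
  moreover have "act (HAD q) = had_amp q" by (intro ext) simp
  ultimately show ?thesis unfolding NOT by (intro ext) (simp del: act.simps(2) add: act.simps(3))
next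
  case (CNOT a b)
  then have ab: "a \<noteq> b" using assms by simp
  have upd: "x(b := \<not> x b) = (if x b then x(b := False) else x(b := True))" "x = (if x b then x(b := True) else x(b := False))"
    for x :: "nat \<Rightarrow> bool" by (simp_all add: fun_upd_idem)
  have "had_amp b (act (CPHASE a b) (had_amp b \<psi>)) x = \<psi> (if x a then x(b := \<not> x b) else x)" for x
    by (subst had_amp_had_amp[where \<psi> = \<psi> and u = "\<lambda>_. 1" and v = "\<lambda>x. if x a then -1 else 1"])
      (use ab upd[of x] in \<open>simp_all add: fun_upd_idem\<close>)
  moreover have "act (HAD b) = had_amp b" by (intro ext) simp
  ultimately show ?thesis unfolding CNOT by (intro ext) (simp del: act.simps(5))
qed simp_all

definition base_step :: "nat \<Rightarrow> nat list list \<times> nat list list \<Rightarrow> gate \<Rightarrow> nat list list \<times> nat list list" where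
  "base_step N st g = (case g of
     HAD q \<Rightarrow> had_step N q st
   | PHASE q \<Rightarrow> (fst st, snd st @ [row_of (fst st) q])
   | CPHASE a b \<Rightarrow> (fst st, snd st @ cz_terms N (row_of (fst st) a) (row_of (fst st) b))
   | _ \<Rightarrow> st)"

definition final_form :: "nat \<Rightarrow> gate list \<Rightarrow> nat list list \<times> nat list list" where
  "final_form N gs = foldl (base_step N) (map (\<lambda>_. []) [0..<N], []) (concat (map to_hpcz gs))"

text \<open>A diagonal gate refers to \<open>x q\<close>, whereas \<open>good\<close> admits
  functionals of pivots only. On satisfying assignments \<open>x q\<close> equals its row, and
  elsewhere the amplitude is zero, so agreement there suffices.\<close>

lemma represents_diagonal:
  assumes "represents N (F, L) \<psi>" and T: "\<And>l. l \<in> set T \<Longrightarrow> canonical N l \<and> set l \<subseteq> insert N (pivots N F)"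
    and D: "\<And>x. sat N F x \<Longrightarrow> phase_factor N x T = d x"
  shows "represents N (F, L @ T) (\<lambda>x. d x * \<psi> x)"
proof -
  obtain \<alpha> where good: "good N F L" and \<alpha>: "cmod \<alpha> = (1 / sqrt 2) ^ card (pivots N F)"
    and \<psi>: "\<psi> = amp N F L \<alpha>" using assms(1) by (auto simp: represents_def)
  have "good N F (L @ T)" using good T unfolding good_def by auto
  moreover have "(\<lambda>x. d x * \<psi> x) = amp N F (L @ T) \<alpha>"
    using D by (auto simp: \<psi> amp_def fun_eq_iff)
  ultimately show ?thesis using \<alpha> unfolding represents_def by auto
qed

lemma represents_base_step:
  assumes "represents N st \<psi>" "gate_on N g" "is_HAD g \<or> is_PHASE g \<or> is_CPHASE g"
  shows "represents N (base_step N st g) (act g \<psi>)"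
proof -
  obtain F L where st: "st = (F, L)" by force
  have good: "good N F L" using assms(1) by (auto simp: represents_def st)
  have row: "row_of F q = F ! q" if "q < N" for q using goodD(1)[OF good] that by (simp add: row_of_def)
  have T: "canonical N (F ! q) \<and> set (F ! q) \<subseteq> insert N (pivots N F)" if "q < N" for q
    using goodD(4,5)[OF good that] by simp
  show ?thesis
  proof (cases g)
    case (HAD q)
    then have "represents N (had_step N q st) (had_amp q \<psi>)" using assms represents_had_step by simp
    moreover have "act g \<psi> = had_amp q \<psi>" by (simp add: HAD fun_eq_iff)
    ultimately show ?thesis by (simp add: base_step_def HAD)
  next
    case (PHASE q)
    then have q: "q < N" using assms by simp
    have "represents N (F, L @ [F ! q]) (\<lambda>x. (if x q then \<i> else 1) * \<psi> x)"
      by (rule represents_diagonal) (use assms(1) st T q in \<open>auto simp: sat_def\<close>)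
    moreover have "act g \<psi> = (\<lambda>x. (if x q then \<i> else 1) * \<psi> x)" by (simp add: PHASE fun_eq_iff)
    ultimately show ?thesis by (simp add: base_step_def PHASE st row q)
  next
    case (CPHASE a b)
    then have ab: "a < N" "b < N" using assms by simp_all
    have "represents N (F, L @ cz_terms N (F ! a) (F ! b)) (\<lambda>x. (if x a \<and> x b then -1 else 1) * \<psi> x)"
    proof (rule represents_diagonal)
      show "canonical N l \<and> set l \<subseteq> insert N (pivots N F)" if "l \<in> set (cz_terms N (F ! a) (F ! b))" for l
        using that T[OF ab(1)] T[OF ab(2)] by (auto simp: cz_terms_def set_xorl)
      show "phase_factor N x (cz_terms N (F ! a) (F ! b)) = (if x a \<and> x b then -1 else 1)" if "sat N F x" for x
      proof -
        have "ev N x (F ! a) = x a" "ev N x (F ! b) = x b" using that ab unfolding sat_def by blast+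
        then show ?thesis using T ab by (simp add: phase_factor_cz_terms)
      qed
    qed (use assms(1) st in simp)
    moreover have "act g \<psi> = (\<lambda>x. (if x a \<and> x b then -1 else 1) * \<psi> x)" by (simp add: CPHASE fun_eq_iff)
    ultimately show ?thesis by (simp add: base_step_def CPHASE st row ab)
  qed (use assms in auto)
qed

lemma represents_final_form:
  assumes "clifford_circuit N gs"
  shows "represents N (final_form N gs) (fold act gs (zero_amp N))"
proof -
  have init: "represents N (map (\<lambda>_. []) [0..<N], []) (zero_amp N)"
  proof -
    have "pivots N (map (\<lambda>_. []) [0..<N]) = {}" by (auto simp: pivots_def)
    then show ?thesis
      by (auto simp: represents_def good_def amp_def sat_def zero_amp_def fun_eq_iff intro!: exI[of _ 1])
  qed
  have base: "represents N (foldl (base_step N) st (to_hpcz g)) (act g \<psi>)" if "represents N st \<psi>" "gate_on N g" for st \<psi> g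
  proof -
    have "represents N (foldl (base_step N) st' hs) (fold act hs \<psi>')"
      if "represents N st' \<psi>'" "\<forall>h\<in>set hs. gate_on N h \<and> (is_HAD h \<or> is_PHASE h \<or> is_CPHASE h)" for st' \<psi>' hs
      using that
    proof (induction hs arbitrary: st' \<psi>')
      case (Cons h hs)
      then have "represents N (base_step N st' h) (act h \<psi>')" by (intro represents_base_step) simp_all
      from Cons.IH[OF this] show ?case using Cons.prems by simp
    qed simp
    moreover have "\<forall>h\<in>set (to_hpcz g). gate_on N h \<and> (is_HAD h \<or> is_PHASE h \<or> is_CPHASE h)"
      using \<open>gate_on N g\<close> by (cases g) auto
    ultimately show ?thesis using \<open>represents N st \<psi>\<close> fold_act_to_hpcz[OF \<open>gate_on N g\<close>] by metis
  qed
  have "represents N (foldl (base_step N) st (concat (map to_hpcz gs))) (fold act gs \<psi>)"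
    if "represents N st \<psi>" "\<forall>g\<in>set gs. gate_on N g" for st \<psi>
    using that
  proof (induction gs arbitrary: st \<psi>)
    case (Cons g gs)
    then have "represents N (foldl (base_step N) st (to_hpcz g)) (act g \<psi>)" by (intro base) simp_all
    from Cons.IH[OF this] show ?case using Cons.prems by simp
  qed simp
  then show ?thesis using init assms unfolding final_form_def clifford_circuit_def by blast
qed

section \<open>Rounds 1 and 2: superposition over the pivots and computation of the rows\<close>

lemma fold_act_map_HAD:
  assumes "distinct qs" "set qs \<subseteq> {..<N}"
  shows "fold act (map HAD qs) (zero_amp N) x =
    (if \<forall>r<N. r \<notin> set qs \<longrightarrow> \<not> x r then (1 / complex_of_real (sqrt 2)) ^ length qs else 0)"
  using assms
proof (induction qs arbitrary: x rule: rev_induct)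
  case (snoc q qs)
  let ?\<psi> = "fold act (map HAD qs) (zero_amp N)"
  have IH: "?\<psi> y = (if \<forall>r<N. r \<notin> set qs \<longrightarrow> \<not> y r then (1 / complex_of_real (sqrt 2)) ^ length qs else 0)" for y
    using snoc by simp
  have q: "q < N" "q \<notin> set qs" using snoc.prems by auto
  \<comment> \<open>Qubit \<open>q\<close> is still 0 before its gate, so only one summand remains
    and is spread over both values of \<open>x q\<close>.\<close>
  then have "\<not> (\<forall>r<N. r \<notin> set qs \<longrightarrow> \<not> (x(q := True)) r)" by auto
  then have T: "?\<psi> (x(q := True)) = 0" unfolding IH by (simp only: if_False)
  have "(\<forall>r<N. r \<notin> set qs \<longrightarrow> \<not> (x(q := False)) r) \<longleftrightarrow> (\<forall>r<N. r \<notin> set (qs @ [q]) \<longrightarrow> \<not> x r)"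
    by auto
  then have F: "?\<psi> (x(q := False)) = (if \<forall>r<N. r \<notin> set (qs @ [q]) \<longrightarrow> \<not> x r then (1 / complex_of_real (sqrt 2)) ^ length qs else 0)"
    unfolding IH by (simp only:)
  have "fold act (map HAD (qs @ [q])) (zero_amp N) x = had_amp q ?\<psi> x" by simp
  also have "\<dots> = (if \<forall>r<N. r \<notin> set (qs @ [q]) \<longrightarrow> \<not> x r then (1 / complex_of_real (sqrt 2)) ^ length qs else 0) / sqrt 2"
    unfolding had_amp_def T F by simp
  also have "\<dots> = (if \<forall>r<N. r \<notin> set (qs @ [q]) \<longrightarrow> \<not> x r then 1 / complex_of_real (sqrt 2) * (1 / complex_of_real (sqrt 2)) ^ length qs else 0)"
    unfolding if_distrib[of "\<lambda>a. a / _"] by auto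
  finally show ?case by (simp only: length_append_singleton power_Suc)
qed (simp add: zero_amp_def)

text \<open>The intermediate states of round 2: \<open>G r\<close> is the part of row
  \<open>r\<close> already added to qubit \<open>r\<close>, and the qubits in \<open>S\<close> are
  free.\<close>

definition affine_amp :: "nat \<Rightarrow> nat set \<Rightarrow> complex \<Rightarrow> (nat \<Rightarrow> nat list) \<Rightarrow> (nat \<Rightarrow> bool) \<Rightarrow> complex" where
  "affine_amp N S \<beta> G x = (if \<forall>r<N. r \<notin> S \<longrightarrow> x r = ev N x (G r) then \<beta> else 0)"

definition row_gate :: "nat \<Rightarrow> nat \<Rightarrow> nat \<Rightarrow> gate" where
  "row_gate N r s = (if s = N then NOT r else CNOT s r)"

text \<open>Rows read qubits in \<open>S\<close> and the constant, while the gate writes to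
  \<open>r\<close> outside \<open>S\<close>. It therefore changes the value of no functional and
  merely adds \<open>s\<close> to row \<open>r\<close>.\<close>

lemma act_row_gate:
  assumes r: "r < N" "r \<notin> S" and s: "s \<in> insert N S" and S: "S \<subseteq> {..<N}"
    and G: "\<And>t. set (G t) \<subseteq> insert N S"
  shows "act (row_gate N r s) (affine_amp N S \<beta> G) = affine_amp N S \<beta> (G(r := s # G r))"
proof
  fix x
  define c where "c = (s = N \<or> x s)"
  define y where "y = (if c then x(r := \<not> x r) else x)"
  have "s \<noteq> N \<Longrightarrow> s \<noteq> r" using r s by auto
  then have act: "act (row_gate N r s) (affine_amp N S \<beta> G) x = affine_amp N S \<beta> G y"
    by (simp add: row_gate_def y_def c_def)
  have "r \<notin> set (G t)" for t using G[of t] r by auto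
  then have ev: "ev N y (G t) = ev N x (G t)" for t
    unfolding y_def by (simp add: ev_upd_notin)
  have y: "y t = (if t = r then x r \<noteq> c else x t)" for t by (auto simp: y_def)
  have "(y t = ev N y (G t)) = (x t = ev N x ((G(r := s # G r)) t))" for t
    unfolding ev y by (simp add: c_def) blast
  then show "act (row_gate N r s) (affine_amp N S \<beta> G) x = affine_amp N S \<beta> (G(r := s # G r)) x"
    unfolding act affine_amp_def by simp
qed

lemma fold_act_row:
  assumes r: "r < N" "r \<notin> S" and S: "S \<subseteq> {..<N}" and "set l \<subseteq> insert N S"
    and G: "\<And>t. set (G t) \<subseteq> insert N S"
  shows "fold act (map (row_gate N r) l) (affine_amp N S \<beta> G) = affine_amp N S \<beta> (G(r := rev l @ G r))"
  using assms(4,5)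
proof (induction l arbitrary: G)
  case (Cons s l)
  have "fold act (map (row_gate N r) (s # l)) (affine_amp N S \<beta> G) =
    fold act (map (row_gate N r) l) (affine_amp N S \<beta> (G(r := s # G r)))"
    using Cons.prems act_row_gate[OF r _ S, of s G \<beta>] by simp
  also have "\<dots> = affine_amp N S \<beta> ((G(r := s # G r))(r := rev l @ (G(r := s # G r)) r))"
    by (rule Cons.IH) (use Cons.prems in auto)
  also have "(G(r := s # G r))(r := rev l @ (G(r := s # G r)) r) = G(r := rev (s # l) @ G r)"
    by (simp add: fun_eq_iff)
  finally show ?case .
qed simp

definition round1 :: "nat \<Rightarrow> nat list list \<Rightarrow> gate list" where
  "round1 N F = map HAD (filter (\<lambda>q. q \<in> set (row_of F q)) [0..<N])"

definition round2 :: "nat \<Rightarrow> nat list list \<Rightarrow> gate list" where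
  "round2 N F = concat (map (\<lambda>r. if r \<in> set (row_of F r) then [] else map (row_gate N r) (row_of F r)) [0..<N])"

text \<open>For n ones among the bits, n mod 2 equals n + 2 * (n choose 2) modulo 4. So \<i> to the
  parity is the product of one \<i> per one and one -1 per pair of ones. The constant index
  \<open>N\<close> is left to \<open>round3\<close>.\<close>

definition term_circuit :: "nat \<Rightarrow> nat list \<Rightarrow> gate list" where
  "term_circuit N l = concat (map (\<lambda>s. PHASE s # map (\<lambda>t. CPHASE t s) (filter (\<lambda>t. t < s \<and> t \<noteq> N) l)) (filter (\<lambda>s. s \<noteq> N) l))"

definition round3 :: "nat \<Rightarrow> nat list list \<Rightarrow> gate list" where
  "round3 N L = concat (map (\<lambda>l. if N \<in> set l then term_circuit N l @ term_circuit N l @ term_circuit N l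
     else term_circuit N l) L)"

lemma ev_append: "ev N x (a @ b) = (ev N x a \<noteq> ev N x b)"
  by (induction a) auto

lemma ev_rev: "ev N x (rev a) = ev N x a"
  by (induction a) (auto simp: ev_append)

lemma fold_act_round12:
  assumes good: "good N F L"
  shows "fold act (round1 N F @ round2 N F) (zero_amp N) x =
    (if sat N F x then (1 / complex_of_real (sqrt 2)) ^ card (pivots N F) else 0)"
proof -
  define S where "S = pivots N F"
  define \<beta> where "\<beta> = (1 / complex_of_real (sqrt 2)) ^ card S"
  have len: "length F = N" by (rule goodD(1)[OF good])
  have S: "S \<subseteq> {..<N}" "finite S" unfolding S_def pivots_def by auto
  have row: "row_of F r = F ! r" "r \<in> set (F ! r) \<longleftrightarrow> r \<in> S" if "r < N" for r
    using that by (simp_all add: row_of_def len S_def pivots_def)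
  define qs where "qs = filter (\<lambda>q. q \<in> set (row_of F q)) [0..<N]"
  have qs: "distinct qs" "set qs = S" unfolding qs_def S_def pivots_def by (auto simp: row_of_def len)
  then have "length qs = card S" using distinct_card by fastforce
  then have r1: "fold act (round1 N F) (zero_amp N) = affine_amp N S \<beta> (\<lambda>_. [])"
    using fold_act_map_HAD[OF qs(1), of N] S(1) unfolding round1_def qs_def[symmetric]
    by (auto simp: fun_eq_iff affine_amp_def qs(2) \<beta>_def)
  have "fold act (concat (map (\<lambda>r. if r \<in> set (row_of F r) then [] else map (row_gate N r) (row_of F r)) rs)) (affine_amp N S \<beta> (\<lambda>_. []))
      = affine_amp N S \<beta> (\<lambda>r. if r \<in> set rs \<and> r \<notin> S then rev (F ! r) else [])"
    if "set rs \<subseteq> {..<N}" "distinct rs" for rs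
    using that
  proof (induction rs rule: rev_induct)
    case (snoc r rs)
    then have r: "r < N" "r \<notin> set rs" by auto
    let ?G = "\<lambda>r. if r \<in> set rs \<and> r \<notin> S then rev (F ! r) else []"
    have sub: "set (F ! t) \<subseteq> insert N S" if "t < N" for t
      using goodD(5)[OF good that] by (simp add: S_def)
    show ?case
    proof (cases "r \<in> S")
      case True
      then have "(\<lambda>t. if t \<in> set (rs @ [r]) \<and> t \<notin> S then rev (F ! t) else []) = ?G" by auto
      then show ?thesis using snoc True row[OF r(1)] by simp
    next
      case False
      have "fold act (map (row_gate N r) (F ! r)) (affine_amp N S \<beta> ?G) = affine_amp N S \<beta> (?G(r := rev (F ! r) @ ?G r))"
        by (rule fold_act_row[OF r(1) False S(1) sub[OF r(1)]]) (use sub snoc.prems in force)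
      moreover have "?G(r := rev (F ! r) @ ?G r) = (\<lambda>t. if t \<in> set (rs @ [r]) \<and> t \<notin> S then rev (F ! t) else [])"
        using r(2) False by (auto simp: fun_eq_iff)
      ultimately show ?thesis using snoc False row[OF r(1)] by simp
    qed
  qed simp
  from this[of "[0..<N]"] have eq: "fold act (round1 N F @ round2 N F) (zero_amp N) =
      affine_amp N S \<beta> (\<lambda>r. if r \<in> set [0..<N] \<and> r \<notin> S then rev (F ! r) else [])"
    unfolding round2_def by (simp add: r1 lessThan_atLeast0)
  have "fold act (round1 N F @ round2 N F) (zero_amp N) x = (if sat N F x then \<beta> else 0)"
  proof -
    \<comment> \<open>For pivots both sides hold: the left one vacuously, the right one because the
      row is \<open>[r]\<close>. Elsewhere the reversal does not affect the sum.\<close>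
    have "(r \<notin> S \<longrightarrow> x r = ev N x (if r \<in> set [0..<N] \<and> r \<notin> S then rev (F ! r) else [])) \<longleftrightarrow> x r = ev N x (F ! r)"
      if "r < N" for r
    proof (cases "r \<in> S")
      case True
      then have "F ! r = [r]" using good_pivot[OF good that] row(2)[OF that] by simp
      then show ?thesis using True that by simp
    qed (use that in \<open>simp add: ev_rev\<close>)
    then show ?thesis unfolding eq affine_amp_def sat_def by presburger
  qed
  then show ?thesis unfolding \<beta>_def S_def .
qed

section \<open>Round 3: diagonal circuits\<close>

fun diag :: "(nat \<Rightarrow> bool) \<Rightarrow> gate \<Rightarrow> complex" where
  "diag x (PHASE q) = (if x q then \<i> else 1)"
| "diag x (CPHASE a b) = (if x a \<and> x b then -1 else 1)"
| "diag x _ = 1"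

definition diag_prod :: "(nat \<Rightarrow> bool) \<Rightarrow> gate list \<Rightarrow> complex" where
  "diag_prod x gs = prod_list (map (diag x) gs)"

lemma diag_prod_simps [simp]:
  "diag_prod x [] = 1" "diag_prod x (g # gs) = diag x g * diag_prod x gs"
  "diag_prod x (gs @ hs) = diag_prod x gs * diag_prod x hs"
  by (simp_all add: diag_prod_def)

lemma fold_act_diag:
  assumes "\<forall>g\<in>set gs. is_PHASE g \<or> is_CPHASE g"
  shows "fold act gs \<psi> x = diag_prod x gs * \<psi> x"
proof -
  have step: "act g \<psi> x = diag x g * \<psi> x" if "is_PHASE g \<or> is_CPHASE g" for g \<psi>
    using that by (cases g) auto
  show ?thesis using assms
    by (induction gs arbitrary: \<psi>) (simp_all add: step)
qed

lemma diag_prod_CPHASE: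
  "diag_prod x (map (\<lambda>t. CPHASE t s) l) = (if x s \<and> odd (length (filter x l)) then -1 else 1)"
  by (induction l) auto

lemma ev_filter_N: "ev N x (filter (\<lambda>s. s \<noteq> N) l) = odd (length (filter x (filter (\<lambda>s. s \<noteq> N) l)))"
  by (induction l) auto

text \<open>Appending a bit y to bits of parity p multiplies by \<i>^y * (-1)^(p * y), which turns
  \<i>^p into \<i> to the parity of all. Sortedness makes the guard \<open>t < s\<close> select
  precisely the earlier indices.\<close>

lemma diag_prod_term_circuit:
  "sorted_wrt (<) l \<Longrightarrow> diag_prod x (term_circuit N l) = (if ev N x (filter (\<lambda>s. s \<noteq> N) l) then \<i> else 1)"
proof (induction l rule: rev_induct)
  case (snoc s l)
  then have less: "\<And>t. t \<in> set l \<Longrightarrow> t < s" and l: "sorted_wrt (<) l" by (auto simp: sorted_wrt_append)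
  define f where "f = (\<lambda>k. PHASE k # map (\<lambda>t. CPHASE t k) (filter (\<lambda>t. t < k \<and> t \<noteq> N) (l @ [s])))"
  have "f k = PHASE k # map (\<lambda>t. CPHASE t k) (filter (\<lambda>t. t < k \<and> t \<noteq> N) l)" if "k \<in> set l" for k
    unfolding f_def using less[OF that] by simp
  then have "map f (filter (\<lambda>s. s \<noteq> N) l) =
      map (\<lambda>k. PHASE k # map (\<lambda>t. CPHASE t k) (filter (\<lambda>t. t < k \<and> t \<noteq> N) l)) (filter (\<lambda>s. s \<noteq> N) l)"
    by (intro map_cong refl) simp
  then have 1: "concat (map f (filter (\<lambda>s. s \<noteq> N) l)) = term_circuit N l"
    by (simp only: term_circuit_def)
  have "filter (\<lambda>t. t < s \<and> t \<noteq> N) l = filter (\<lambda>t. t \<noteq> N) l"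
    by (rule filter_cong[OF refl]) (use less in auto)
  then have 2: "f s = PHASE s # map (\<lambda>t. CPHASE t s) (filter (\<lambda>t. t \<noteq> N) l)"
    by (simp add: f_def)
  have "term_circuit N (l @ [s]) = concat (map f (filter (\<lambda>s. s \<noteq> N) (l @ [s])))"
    by (simp only: term_circuit_def f_def)
  also have "\<dots> = term_circuit N l @ (if s = N then [] else f s)"
    unfolding 1[symmetric] by simp
  finally have eq: "term_circuit N (l @ [s]) = term_circuit N l @
      (if s = N then [] else PHASE s # map (\<lambda>t. CPHASE t s) (filter (\<lambda>t. t \<noteq> N) l))"
    unfolding 2 .
  show ?case
    using snoc.IH[OF l] by (simp add: eq diag_prod_CPHASE ev_append ev_filter_N)
qed (simp add: term_circuit_def)

text \<open>Since \<open>\<i> ^ (1 - y) = \<i> * \<i> ^ (3 * y)\<close> for a bit \<open>y\<close>, every functional with a constant term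
  contributes one factor \<open>\<i>\<close> to the global phase.\<close>

lemma diag_prod_round3:
  assumes "\<And>l. l \<in> set L \<Longrightarrow> canonical N l"
  shows "\<exists>\<gamma>. cmod \<gamma> = 1 \<and> (\<forall>x. phase_factor N x L = \<gamma> * diag_prod x (round3 N L))"
  using assms
proof (induction L)
  case (Cons l L)
  then obtain \<gamma> where \<gamma>: "cmod \<gamma> = 1" "\<And>x. phase_factor N x L = \<gamma> * diag_prod x (round3 N L)" by auto
  have l: "canonical N l" using Cons.prems by simp
  have tc: "diag_prod x (term_circuit N l) = (if ev N x (filter (\<lambda>s. s \<noteq> N) l) then \<i> else 1)" for x
    by (rule diag_prod_term_circuit[OF canonical_sorted[OF l]])
  have "distinct k \<Longrightarrow> ev N x k = (ev N x (filter (\<lambda>s. s \<noteq> N) k) \<noteq> (N \<in> set k))" for x k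
    by (induction k) auto
  then have ev: "ev N x l = (ev N x (filter (\<lambda>s. s \<noteq> N) l) \<noteq> (N \<in> set l))" for x
    using canonical_distinct[OF l] .
  let ?c = "if N \<in> set l then \<i> else 1"
  have "phase_factor N x (l # L) = (?c * \<gamma>) * diag_prod x (round3 N (l # L))" for x
    using \<gamma>(2)[of x] tc[of x] ev[of x] by (simp add: round3_def)
  then show ?case using \<gamma>(1) by (intro exI[of _ "?c * \<gamma>"]) (simp add: norm_mult)
qed (auto simp: round3_def intro: exI[of _ 1])

lemma gates_of_rounds:
  assumes good: "good N F L"
  shows "hadamard_round N (round1 N F)" "not_cnot_round N (round2 N F)" "phase_cphase_round N (round3 N L)"
proof -
  show "hadamard_round N (round1 N F)"
    unfolding hadamard_round_def round1_def
    by (rule exI[of _ "filter (\<lambda>q. q \<in> set (row_of F q)) [0..<N]"]) auto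
  have "gate_on N g \<and> (is_NOT g \<or> is_CNOT g)" if g: "g \<in> set (round2 N F)" for g
  proof -
    obtain r s where rs: "r < N" "r \<notin> set (row_of F r)" "s \<in> set (row_of F r)" "g = row_gate N r s"
      using g by (auto simp: round2_def split: if_splits)
    then have "s \<in> set (F ! r)" "r \<noteq> s" using goodD(1)[OF good] by (auto simp: row_of_def)
    then have "s = N \<or> s < N" using goodD(5)[OF good rs(1)] by (auto simp: pivots_def)
    then show ?thesis using rs(1,4) \<open>r \<noteq> s\<close> by (auto simp: row_gate_def)
  qed
  then show "not_cnot_round N (round2 N F)" unfolding not_cnot_round_def clifford_circuit_def by blast
  have "gate_on N g \<and> (is_PHASE g \<or> is_CPHASE g)" if "g \<in> set (term_circuit N l)" "canonical N l" for g l
  proof -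
    have "k \<le> N" if "k \<in> set l" for k using canonical_le[OF \<open>canonical N l\<close> that] .
    then show ?thesis using that(1) by (fastforce simp: term_circuit_def)
  qed
  moreover have "\<exists>l. canonical N l \<and> g \<in> set (term_circuit N l)" if "g \<in> set (round3 N L)" for g
    using that goodD(2)[OF good] by (auto simp: round3_def split: if_splits)
  ultimately show "phase_cphase_round N (round3 N L)"
    unfolding phase_cphase_round_def clifford_circuit_def by blast
qed

definition rounds :: "nat \<Rightarrow> gate list \<Rightarrow> gate list \<times> gate list \<times> gate list" where
  "rounds N gs = (let st = final_form N gs in (round1 N (fst st), round2 N (fst st), round3 N (snd st)))"

lemma rounds_correct:
  assumes cc: "clifford_circuit N gs" and eq: "rounds N gs = (r1, r2, r3)"
  shows "hadamard_round N r1" "not_cnot_round N r2" "phase_cphase_round N r3"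
    "clifford_circuit N (r1 @ r2 @ r3)"
    "equal_up_to_phase (apply_circuit N gs (zero_state N)) (apply_circuit N (r1 @ r2 @ r3) (zero_state N))"
proof -
  obtain F L where st: "final_form N gs = (F, L)" by force
  have r: "r1 = round1 N F" "r2 = round2 N F" "r3 = round3 N L"
    using eq by (auto simp: rounds_def st)
  obtain \<alpha> where good: "good N F L" and \<alpha>: "cmod \<alpha> = (1 / sqrt 2) ^ card (pivots N F)"
    and \<psi>: "fold act gs (zero_amp N) = amp N F L \<alpha>"
    using represents_final_form[OF cc] by (auto simp: represents_def st)
  show rnds: "hadamard_round N r1" "not_cnot_round N r2" "phase_cphase_round N r3"
    unfolding r by (rule gates_of_rounds[OF good])+
  then show cc': "clifford_circuit N (r1 @ r2 @ r3)"
    by (auto simp: hadamard_round_def not_cnot_round_def phase_cphase_round_def clifford_circuit_def subset_eq)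
  let ?\<beta> = "(1 / complex_of_real (sqrt 2)) ^ card (pivots N F)"
  obtain \<gamma> where \<gamma>: "cmod \<gamma> = 1" "\<And>x. phase_factor N x L = \<gamma> * diag_prod x r3"
    using diag_prod_round3[of L N] goodD(2)[OF good] r(3) by blast
  have "\<forall>g\<in>set r3. is_PHASE g \<or> is_CPHASE g" using rnds(3) by (simp add: phase_cphase_round_def)
  then have C': "fold act (r1 @ r2 @ r3) (zero_amp N) x = diag_prod x r3 * (if sat N F x then ?\<beta> else 0)" for x
    using fold_act_round12[OF good, of x] fold_act_diag[of r3 "fold act (r1 @ r2) (zero_amp N)" x]
    by (simp add: r)
  have \<beta>: "?\<beta> \<noteq> 0" by simp
  \<comment> \<open>\<gamma> collects the constants of the functionals. \<alpha> and
    \<open>?\<beta>\<close> have the same modulus by \<open>represents\<close>, so c has modulus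
    one.\<close>
  define c where "c = \<alpha> * \<gamma> / ?\<beta>"
  have "fold act gs (zero_amp N) x = c * fold act (r1 @ r2 @ r3) (zero_amp N) x" for x
    unfolding C' \<psi> amp_def \<gamma>(2) c_def using \<beta> by simp
  then have "vec_of N (fold act gs (zero_amp N)) = c \<cdot>\<^sub>v vec_of N (fold act (r1 @ r2 @ r3) (zero_amp N))"
    by (auto simp: vec_of_def)
  moreover have "cmod c = 1"
    using \<alpha> \<gamma>(1) by (simp add: c_def norm_mult norm_divide norm_power)
  ultimately show "equal_up_to_phase (apply_circuit N gs (zero_state N)) (apply_circuit N (r1 @ r2 @ r3) (zero_state N))"
    unfolding equal_up_to_phase_def zero_state_vec_of apply_circuit_vec_of[OF cc] apply_circuit_vec_of[OF cc'] by blast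
qed

section \<open>Running time of the algorithm\<close>

lemma ptime_eq_bool [ptime_intros]: "ptime b \<Longrightarrow> ptime c \<Longrightarrow> ptime (\<lambda>x. b x = (c x :: bool))"
  by (rule ptime_cong_enc[OF ptime_if[of b c "\<lambda>x. \<not> c x"]]) (auto intro: ptime_not)

lemma ptime_replicate [ptime_intros]:
  assumes "ptime f" "ptime g"
  shows "ptime (\<lambda>z. replicate (f z) (g z))"
proof -
  have "ptime (\<lambda>z. map (\<lambda>_. g z) [0..<f z])" by (intro ptime_intros assms ptime_comp[OF assms(2)])
  then show ?thesis by (simp add: map_replicate_const)
qed

lemma ptime_length_mod4:
  assumes "ptime f"
  shows "ptime (\<lambda>z. length (f z) mod 4)"
proof -
  have "ptime (\<lambda>z. foldl (\<lambda>a _. if a = 3 then 0 else Suc a) 0 (f z))"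
    by (intro ptime_foldl_additive[where q = "[:1:]"] ptime_intros assms) auto
  moreover have "foldl (\<lambda>a _. if a = 3 then 0 else Suc a) a xs = (a + length xs) mod 4" if "a < 4" for a and xs :: "'b list"
    using that
  proof (induction xs arbitrary: a)
    case (Cons x xs)
    have "(3 + length (x # xs)) mod 4 = length xs mod 4" by simp
    then show ?case using Cons.IH[of 0] Cons.IH[of "Suc a"] Cons.prems by (cases "a = 3") simp_all
  qed simp
  ultimately show ?thesis by simp
qed

lemma ptime_hd0: "ptime hd0"
proof (rule ptime_exp[of "LeftE (Var 0)"])
  show "enc (hd0 xs) = eval_exp (LeftE (Var 0)) (\<lambda>_. enc xs)" for xs by (cases xs) auto
qed auto

lemma ptime_row_of [ptime_intros]:
  fixes f :: "'z::enc \<Rightarrow> 'x::enc list list"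
  assumes "ptime f" "ptime g"
  shows "ptime (\<lambda>z. row_of (f z) (g z))"
proof -
  have hd: "ptime (\<lambda>xs :: 'x list list. if xs = [] then [] else hd xs)"
  proof (rule ptime_exp[of "LeftE (Var 0)"])
    show "enc (if xs = [] then [] else hd xs) = eval_exp (LeftE (Var 0)) (\<lambda>_. enc xs)" for xs :: "'x list list"
      by (cases xs) auto
  qed auto
  have tl_size: "size (enc (tl xs)) \<le> size (enc xs)" for xs :: "'x list list" by (cases xs) auto
  have "ptime (\<lambda>z. foldl (\<lambda>a _. tl a) (f z) (replicate (g z) ()))"
    by (intro ptime_foldl_additive[where q = 0] ptime_intros assms ptime_replicate_unit) (simp add: tl_size)
  moreover have "foldl (\<lambda>a _. tl a) xs (replicate n ()) = drop n xs" for n and xs :: "'x list list"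
    by (induction n arbitrary: xs) (auto simp: drop_Suc)
  ultimately have "ptime (\<lambda>z. drop (g z) (f z))" by simp
  from ptime_comp[OF hd this] show ?thesis
    by (rule ptime_cong_enc) (auto simp: row_of_def hd_drop_conv_nth)
qed

lemma size_xorl: "size (enc (xorl N a b)) \<le> size (enc [0..<Suc N])"
  unfolding xorl_def by (rule size_enc_filter_le)

lemma ptime_xorl [ptime_intros]:
  "ptime f \<Longrightarrow> ptime g \<Longrightarrow> ptime h \<Longrightarrow> ptime (\<lambda>z. xorl (f z) (g z) (h z))"
  by (rule ptime_comp3[of xorl], unfold xorl_def) (intro ptime_intros)+

lemma ptime_cz_terms [ptime_intros]:
  "ptime f \<Longrightarrow> ptime g \<Longrightarrow> ptime h \<Longrightarrow> ptime (\<lambda>z. cz_terms (f z) (g z) (h z))"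
  unfolding cz_terms_def by (intro ptime_intros)

lemma ptime_xor_all [ptime_intros]:
  assumes f: "ptime f" and g: "ptime g"
  shows "ptime (\<lambda>z. xor_all (f z) (g z))"
proof -
  have "ptime (\<lambda>z. [0..<Suc (f z)])" by (intro ptime_intros f)
  then obtain q where q: "\<And>z. size (enc [0..<Suc (f z)]) \<le> poly q (size (enc z))" using ptime_size by blast
  \<comment> \<open>The output of \<open>xorl\<close> is bounded by \<open>f z\<close> alone,
    whatever the accumulator is.\<close>
  have "size (enc (xorl (f z) a x)) \<le> size (enc a) + poly q (size (enc z))" for z a x
    using size_xorl[of "f z" a x] q[of z] by linarith
  then show ?thesis unfolding xor_all_def
    by (intro ptime_foldl_additive[where q = q] ptime_intros ptime_comp[OF f] g)
qed

lemma ptime_had_slope [ptime_intros]: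
  assumes "ptime f" "ptime g" "ptime h"
  shows "ptime (\<lambda>z. had_slope (f z) (g z) (h z))"
  by (rule ptime_comp3[of had_slope, OF _ assms], unfold had_slope_def) (intro ptime_intros)

lemma ptime_had_count [ptime_intros]:
  assumes "ptime g" "ptime h"
  shows "ptime (\<lambda>z. had_count (g z) (h z))"
  by (rule ptime_comp2[of had_count, OF _ assms], unfold had_count_def) (intro ptime_intros ptime_length_mod4)

lemma ptime_set_row [ptime_intros]:
  assumes "ptime f" "ptime g" "ptime h" "ptime k"
  shows "ptime (\<lambda>z. set_row (f z) (g z) (h z) (k z))"
  unfolding set_row_def
  by (intro ptime_intros assms ptime_comp[OF assms(1)] ptime_comp[OF assms(2)] ptime_comp[OF assms(3)] ptime_comp[OF assms(4)])

lemma ptime_subst [ptime_intros]: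
  assumes "ptime f" "ptime g" "ptime h" "ptime k" "ptime l"
  shows "ptime (\<lambda>z. subst_var (f z) (g z) (h z) (k z) (l z))"
  unfolding subst_var_def by (intro ptime_intros assms)

lemma ptime_swap_pivot [ptime_intros]:
  assumes "ptime f" "ptime g" "ptime h" "ptime k"
  shows "ptime (\<lambda>z. swap_pivot (f z) (g z) (h z) (k z))"
  unfolding swap_pivot_def
  by (intro ptime_intros assms ptime_comp[OF assms(1)] ptime_comp[OF assms(2)] ptime_comp[OF assms(3)] ptime_comp[OF assms(4)])

lemma ptime_had_free_step [ptime_intros]:
  assumes "ptime f" "ptime g" "ptime h"
  shows "ptime (\<lambda>z. had_free_step (f z) (g z) (h z))"
  unfolding had_free_step_def by (intro ptime_intros assms)

lemma ptime_had_pivot_step [ptime_intros]: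
  assumes "ptime f" "ptime g" "ptime h"
  shows "ptime (\<lambda>z. had_pivot_step (f z) (g z) (h z))"
  by (rule ptime_comp3[of had_pivot_step, OF _ assms], unfold had_pivot_step_def Let_def) (intro ptime_intros)

lemma ptime_pivot_rows [ptime_intros]:
  assumes "ptime f" "ptime g" "ptime h"
  shows "ptime (\<lambda>z. pivot_rows (f z) (g z) (h z))"
  by (rule ptime_comp3[of pivot_rows, OF _ assms], unfold pivot_rows_def) (intro ptime_intros)

lemma ptime_had_step [ptime_intros]:
  assumes "ptime f" "ptime g" "ptime h"
  shows "ptime (\<lambda>z. had_step (f z) (g z) (h z))"
  unfolding had_step_def by (intro ptime_intros ptime_comp[OF ptime_hd0] assms)

section \<open>Access to the parts of an encoded gate\<close>

fun gate_tag :: "gate \<Rightarrow> nat" where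
  "gate_tag (HAD q) = 0"
| "gate_tag (PHASE q) = 1"
| "gate_tag (NOT q) = 2"
| "gate_tag (CNOT a b) = 3"
| "gate_tag (CPHASE a b) = 4"

fun gate_arg1 :: "gate \<Rightarrow> nat" where
  "gate_arg1 (HAD q) = q"
| "gate_arg1 (PHASE q) = q"
| "gate_arg1 (NOT q) = q"
| "gate_arg1 (CNOT a b) = a"
| "gate_arg1 (CPHASE a b) = a"

text \<open>The junk value for one-qubit gates makes the function a plain tree projection.\<close>

fun gate_arg2 :: "gate \<Rightarrow> nat" where
  "gate_arg2 (HAD q) = q - 1"
| "gate_arg2 (PHASE q) = q - 1"
| "gate_arg2 (NOT q) = q - 1"
| "gate_arg2 (CNOT a b) = b"
| "gate_arg2 (CPHASE a b) = b"

text \<open>Raw subtrees become values of the calculus. \<open>gate_arg1\<close> needs this: its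
  argument sits at different depths for one-qubit and two-qubit gates, and the other subtree need
  not encode a number.\<close>

instantiation tree :: enc
begin
definition enc_tree :: "tree \<Rightarrow> tree" where "enc_tree t = t"
instance ..
end

lemma enc_gate_tag: "enc g = Node (enc (gate_tag g)) (right (enc g))"
  by (cases g) (simp_all add: enc_gate_inst enc_nat_inst)

lemma ptime_gate_tag: "ptime gate_tag"
  by (rule ptime_exp[of "LeftE (Var 0)"]) (simp, subst enc_gate_tag, simp)

lemma ptime_gate_arg2: "ptime gate_arg2"
proof (rule ptime_exp[of "RightE (RightE (Var 0))"])
  have "enc (q - 1 :: nat) = right (enc q)" for q by (cases q) auto
  then show "enc (gate_arg2 g) = eval_exp (RightE (RightE (Var 0))) (\<lambda>_. enc g)" for g
    by (cases g) (simp_all add: enc_gate_inst enc_nat_inst)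
qed simp

lemma ptime_gate_arg1: "ptime gate_arg1"
proof -
  have "ptime (\<lambda>g :: gate. right (enc g))" "ptime (\<lambda>g :: gate. left (right (enc g)))"
    by (rule ptime_exp[of "RightE (Var 0)"] ptime_exp[of "LeftE (RightE (Var 0))"]; simp add: enc_tree_def)+
  then have "ptime (\<lambda>g. if gate_tag g < 3 then right (enc g) else left (right (enc g)))"
    by (intro ptime_intros ptime_gate_tag)
  then show ?thesis
  proof (rule ptime_cong_enc)
    show "enc (gate_arg1 g) = enc (if gate_tag g < 3 then right (enc g) else left (right (enc g)))" for g
      by (cases g) (simp_all add: enc_gate_inst enc_nat_inst enc_tree_def)
  qed
qed

lemma ptime_gate_args [ptime_intros]:
  assumes "ptime f"
  shows "ptime (\<lambda>z. gate_tag (f z))" "ptime (\<lambda>z. gate_arg1 (f z))" "ptime (\<lambda>z. gate_arg2 (f z))"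
  by (rule ptime_comp[OF ptime_gate_tag assms] ptime_comp[OF ptime_gate_arg1 assms]
      ptime_comp[OF ptime_gate_arg2 assms])+

lemma ptime_one_qubit_gates [ptime_intros]:
  assumes "ptime f"
  shows "ptime (\<lambda>z. HAD (f z))" "ptime (\<lambda>z. PHASE (f z))" "ptime (\<lambda>z. NOT (f z))"
proof -
  have *: "ptime (\<lambda>z. (n :: nat, f z))" for n by (intro ptime_intros assms)
  show "ptime (\<lambda>z. HAD (f z))"
    by (rule ptime_cong_enc[OF *[of 0]]) (simp add: enc_gate_inst enc_nat_inst)
  show "ptime (\<lambda>z. PHASE (f z))"
    by (rule ptime_cong_enc[OF *[of 1]]) (simp add: enc_gate_inst enc_nat_inst)
  show "ptime (\<lambda>z. NOT (f z))"
    by (rule ptime_cong_enc[OF *[of 2]]) (simp add: enc_gate_inst enc_nat_inst)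
qed

lemma ptime_two_qubit_gates [ptime_intros]:
  assumes "ptime f" "ptime g"
  shows "ptime (\<lambda>z. CNOT (f z) (g z))" "ptime (\<lambda>z. CPHASE (f z) (g z))"
proof -
  have *: "ptime (\<lambda>z. (n :: nat, f z, g z))" for n by (intro ptime_intros assms)
  show "ptime (\<lambda>z. CNOT (f z) (g z))"
    by (rule ptime_cong_enc[OF *[of 3]]) (simp add: enc_gate_inst enc_nat_inst)
  show "ptime (\<lambda>z. CPHASE (f z) (g z))"
    by (rule ptime_cong_enc[OF *[of 4]]) (simp add: enc_gate_inst enc_nat_inst)
qed

lemma ptime_to_hpcz: "ptime to_hpcz"
proof -
  have eq: "to_hpcz g =
    (if gate_tag g = 2 then [HAD (gate_arg1 g), PHASE (gate_arg1 g), PHASE (gate_arg1 g), HAD (gate_arg1 g)]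
     else if gate_tag g = 3 then [HAD (gate_arg2 g), CPHASE (gate_arg1 g) (gate_arg2 g), HAD (gate_arg2 g)]
     else [g])" for g by (cases g) auto
  show ?thesis by (subst eq[abs_def]) (intro ptime_intros)
qed

text \<open>The case distinction on constructors becomes a chain of tests on the tag, a form to
  which the closure properties apply.\<close>

lemma base_step_eq: "base_step N st g =
  (if gate_tag g = 0 then had_step N (gate_arg1 g) st
   else if gate_tag g = 1 then (fst st, snd st @ [row_of (fst st) (gate_arg1 g)])
   else if gate_tag g = 4 then
     (fst st, snd st @ cz_terms N (row_of (fst st) (gate_arg1 g)) (row_of (fst st) (gate_arg2 g)))
   else st)"
  by (cases g) (simp_all add: base_step_def)

lemma ptime_base_step [ptime_intros]:
  assumes "ptime f" "ptime g" "ptime h"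
  shows "ptime (\<lambda>z. base_step (f z) (g z) (h z))"
  unfolding base_step_eq by (intro ptime_intros assms)

text \<open>The size invariant for arbitrary gate lists, independent of \<open>good\<close>. The
  number \<open>k\<close> of phase functionals rises by at most 5 per step, the length of
  \<open>cz_terms\<close>; the bound on each functional never changes.\<close>

definition small :: "nat \<Rightarrow> nat \<Rightarrow> nat list list \<times> nat list list \<Rightarrow> bool" where
  "small N k st \<longleftrightarrow> length (fst st) = N \<and> length (snd st) \<le> k \<and>
     (\<forall>l\<in>set (fst st) \<union> set (snd st). size (enc l) \<le> size (enc [0..<Suc N]))"

lemma size_row_of:
  assumes "small N k st"
  shows "size (enc (row_of (fst st) q)) \<le> size (enc [0..<Suc N])"
  using assms by (auto simp: small_def row_of_def simp del: upt_Suc)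

text \<open>Only the last application of \<open>xorl\<close> matters, since its result is short for
  any arguments.\<close>

lemma size_xor_all: "size (enc (xor_all N U)) \<le> size (enc [0..<Suc N])"
proof (cases U rule: rev_cases)
  case (snoc V l)
  then show ?thesis using size_xorl[of N "xor_all N V" l] by (simp add: xor_all_def del: upt_Suc)
qed (simp add: xor_all_def)

lemma small_set_row:
  assumes "small N k st" "size (enc v) \<le> size (enc [0..<Suc N])"
  shows "\<forall>l\<in>set (set_row N (fst st) q v). size (enc l) \<le> size (enc [0..<Suc N])"
  using assms(2) size_row_of[OF assms(1)] by (auto simp: set_row_def simp del: upt_Suc)

lemma length_set_row: "length (set_row N F q v) = N"
  by (simp add: set_row_def)

lemma small_append:
  assumes "small N k st" "\<forall>l\<in>set F. size (enc l) \<le> size (enc [0..<Suc N])" "length F = N"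
    and "\<forall>l\<in>set T. size (enc l) \<le> size (enc [0..<Suc N])" "length T \<le> 5"
  shows "small N (k + 5) (F, snd st @ T)"
  using assms unfolding small_def by (auto simp del: upt_Suc)

lemma size_cz_terms:
  assumes "size (enc a) \<le> size (enc [0..<Suc N])" "size (enc b) \<le> size (enc [0..<Suc N])"
  shows "\<forall>l\<in>set (cz_terms N a b). size (enc l) \<le> size (enc [0..<Suc N])"
  using assms size_xorl[of N a b] by (auto simp: cz_terms_def simp del: upt_Suc)

lemma length_cz_terms: "length (cz_terms N a b) = 5"
  by (simp add: cz_terms_def)

lemma small_fst: "small N k st \<Longrightarrow> (\<forall>l\<in>set (fst st). size (enc l) \<le> size (enc [0..<Suc N])) \<and> length (fst st) = N"
  by (auto simp: small_def simp del: upt_Suc)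

lemma small_had_free_step: "small N k st \<Longrightarrow> small N (k + 5) (had_free_step N q st)"
  unfolding had_free_step_def
  by (intro small_append small_set_row size_cz_terms size_xorl size_row_of)
    (assumption | simp add: length_set_row length_cz_terms)+

lemma small_swap_pivot: "small N k st \<Longrightarrow> small N k (swap_pivot N q r st)"
  using size_xorl by (auto simp: small_def swap_pivot_def subst_var_def simp del: upt_Suc)

lemma small_had_pivot_step:
  assumes "small N k st"
  shows "small N (k + 5) (had_pivot_step N q st)"
proof -
  define L0 where "L0 = map (filter (\<lambda>i. i \<noteq> q)) (snd st)"
  have st0: "small N k (fst st, L0)"
    using assms order_trans[OF size_enc_filter_le] unfolding small_def L0_def by (auto simp del: upt_Suc)
  have m: "size (enc (had_slope N q (snd st))) \<le> size (enc [0..<Suc N])"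
    unfolding had_slope_def by (rule size_xor_all)
  have 1: "small N (k + 5) (set_row N (fst st) q v, L0)" if "size (enc v) \<le> size (enc [0..<Suc N])" for v
    using small_append[OF st0 small_set_row[OF assms that] length_set_row, of "[]"] by simp
  have "small N (k + 5) (fst st, L0 @ replicate (4 - c) (xorl N m [q]))" for c m
    using small_append[OF st0, of "fst st" "replicate (4 - c) (xorl N m [q])"] small_fst[OF assms] size_xorl[of N m "[q]"]
    by (simp del: upt_Suc)
  then show ?thesis
    unfolding had_pivot_step_def Let_def L0_def[symmetric] using 1 m size_xorl by (simp del: upt_Suc)
qed

lemma small_base_step:
  assumes "small N k st"
  shows "small N (k + 5) (base_step N st g)"
proof -
  have mono: "small N (k + 5) st'" if "small N k st'" for st' using that by (auto simp: small_def)
  have had: "small N (k + 5) (had_step N q st)" for q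
    unfolding had_step_def
    using small_had_pivot_step[OF assms] small_had_free_step[OF small_swap_pivot[OF assms]] small_had_free_step[OF assms]
    by simp
  have 1: "small N (k + 5) (fst st, snd st @ T)"
    if "\<forall>l\<in>set T. size (enc l) \<le> size (enc [0..<Suc N])" "length T \<le> 5" for T
    using small_append[OF assms _ _ that] small_fst[OF assms] by blast
  show ?thesis
    unfolding base_step_eq
    using had mono[OF assms] 1[of "[row_of (fst st) (gate_arg1 g)]"] size_row_of[OF assms]
      1[OF size_cz_terms[OF size_row_of[OF assms] size_row_of[OF assms]]]
    by (simp add: length_cz_terms del: upt_Suc)
qed

lemma small_size:
  assumes "small N k st"
  shows "size (enc st) \<le> 1 + (N + k) * Suc ((N + 1) * (N + 2))"
proof -
  let ?B = "(N + 1) * (N + 2)"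
  have B: "size (enc [0..<Suc N]) \<le> ?B"
    using size_enc_le[of "[0..<Suc N]" "N"] by (simp del: upt_Suc)
  then have "size (enc (fst st)) \<le> length (fst st) * Suc ?B" "size (enc (snd st)) \<le> length (snd st) * Suc ?B"
    using assms by (intro size_enc_le; force simp: small_def simp del: upt_Suc)+
  moreover have "length (fst st) * Suc ?B + length (snd st) * Suc ?B \<le> (N + k) * Suc ?B"
    using assms unfolding add_mult_distrib[symmetric] small_def by (intro mult_right_mono) auto
  ultimately show ?thesis unfolding enc_prod_fst_snd[of st] by simp
qed

lemma ptime_final_form: "ptime (\<lambda>p. final_form (fst p) (snd p))"
proof -
  let ?hs = "\<lambda>p :: nat \<times> gate list. concat (map to_hpcz (snd p))"
  have hs: "ptime ?hs" by (intro ptime_intros ptime_comp[OF ptime_to_hpcz])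
  then obtain r where r: "\<And>p. size (enc (?hs p)) \<le> poly r (size (enc p))" using ptime_size by blast
  have small: "small N (k + 5 * length hs) (foldl (base_step N) st hs)" if "small N k st" for N k st hs
    using that
  proof (induction hs arbitrary: k st)
    case (Cons h hs)
    from Cons.IH[OF small_base_step[OF Cons.prems, of h]] show ?case by (simp add: algebra_simps)
  qed simp
  \<comment> \<open>The bound of \<open>small_size\<close> with \<open>N\<close> at most n and at
    most 5 * \<open>poly r n\<close> functionals, \<open>r\<close> bounding the expanded
    circuit.\<close>
  let ?q = "[:1:] + ([:0, 1:] + [:5:] * r) * ([:1:] + [:1, 1:] * [:2, 1:])"
  show ?thesis unfolding final_form_def
  proof (rule ptime_foldl[where q = ?q])
    fix p :: "nat \<times> gate list" and k
    let ?N = "fst p" and ?n = "size (enc p)"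
    have len: "length (take k (?hs p)) \<le> poly r ?n"
      using length_le_size_enc[of "?hs p"] r[of p] by simp
    have N: "?N \<le> ?n" by (simp add: enc_prod_fst_snd)
    have "small ?N 0 (map (\<lambda>_. []) [0..<?N], [])" by (auto simp: small_def)
    from small_size[OF small[OF this]]
    have "size (enc (foldl (base_step ?N) (map (\<lambda>_. []) [0..<?N], []) (take k (?hs p)))) \<le>
      1 + (?N + (0 + 5 * length (take k (?hs p)))) * Suc ((?N + 1) * (?N + 2))" .
    also have "\<dots> \<le> 1 + (?n + 5 * poly r ?n) * Suc ((?n + 1) * (?n + 2))"
      using N len by (intro add_left_mono mult_mono Suc_le_mono[THEN iffD2]) auto
    also have "\<dots> = poly ?q ?n" by (simp add: algebra_simps)
    finally show "size (enc (foldl (base_step ?N) (map (\<lambda>_. []) [0..<?N], []) (take k (?hs p)))) \<le> poly ?q ?n" .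
  qed (intro ptime_intros hs)+
qed

lemma ptime_round1 [ptime_intros]:
  assumes "ptime f" "ptime g"
  shows "ptime (\<lambda>z. round1 (f z) (g z))"
  by (rule ptime_comp2[of round1, OF _ assms], unfold round1_def) (intro ptime_intros)

lemma ptime_round2 [ptime_intros]:
  assumes "ptime f" "ptime g"
  shows "ptime (\<lambda>z. round2 (f z) (g z))"
  by (rule ptime_comp2[of round2, OF _ assms], unfold round2_def row_gate_def) (intro ptime_intros)

lemma ptime_term_circuit [ptime_intros]:
  assumes "ptime f" "ptime g"
  shows "ptime (\<lambda>z. term_circuit (f z) (g z))"
  by (rule ptime_comp2[of term_circuit, OF _ assms], unfold term_circuit_def) (intro ptime_intros)

lemma ptime_round3 [ptime_intros]:
  assumes "ptime f" "ptime g"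
  shows "ptime (\<lambda>z. round3 (f z) (g z))"
  by (rule ptime_comp2[of round3, OF _ assms], unfold round3_def) (intro ptime_intros)

lemma ptime_rounds: "ptime (\<lambda>p. rounds (fst p) (snd p))"
  unfolding rounds_def Let_def by (intro ptime_intros ptime_final_form)

section \<open>Uniform families\<close>

text \<open>The initial store of \<open>computes\<close> is empty apart from variable
  \<open>0\<close> and so meets the scratch condition of \<open>implements\<close>.\<close>

lemma ptime_computes:
  assumes "ptime f"
  shows "\<exists>c p. \<forall>x. \<exists>t. computes c (enc x) (enc (f x)) t \<and> t \<le> poly p (size (enc x))"
proof -
  obtain c m p where c: "implements c m p f" using assms unfolding ptime_def by blast
  have "\<exists>t. computes c (enc x) (enc (f x)) t \<and> t \<le> poly p (size (enc x))" for x
    using implementsD[OF c, of "(\<lambda>_. Leaf)(0 := enc x)" x] unfolding runs_def computes_def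
    by (metis fun_upd_apply less_not_refl)
  then show ?thesis by blast
qed

section \<open>Arbitrary programs made composable: variables used and cleanup\<close>

fun exp_below :: "nat \<Rightarrow> exp \<Rightarrow> bool" where
  "exp_below m (Var x) \<longleftrightarrow> x < m"
| "exp_below m LeafE \<longleftrightarrow> True"
| "exp_below m (NodeE a b) \<longleftrightarrow> exp_below m a \<and> exp_below m b"
| "exp_below m (LeftE a) \<longleftrightarrow> exp_below m a"
| "exp_below m (RightE a) \<longleftrightarrow> exp_below m a"

fun com_below :: "nat \<Rightarrow> com \<Rightarrow> bool" where
  "com_below m Skip \<longleftrightarrow> True"
| "com_below m (Assign x e) \<longleftrightarrow> x < m \<and> exp_below m e"
| "com_below m (Seq c d) \<longleftrightarrow> com_below m c \<and> com_below m d"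
| "com_below m (If e c d) \<longleftrightarrow> exp_below m e \<and> com_below m c \<and> com_below m d"
| "com_below m (While e c) \<longleftrightarrow> exp_below m e \<and> com_below m c"

lemma exp_below_mono: "exp_below m e \<Longrightarrow> m \<le> n \<Longrightarrow> exp_below n e"
  by (induction e) auto

lemma com_below_mono: "com_below m c \<Longrightarrow> m \<le> n \<Longrightarrow> com_below n c"
  by (induction c) (auto intro: exp_below_mono)

lemma ex_exp_below: "\<exists>m. exp_below m e"
proof (induction e)
  case (NodeE a b)
  then obtain m n where "exp_below m a" "exp_below n b" by blast
  then show ?case by (intro exI[of _ "max m n"]) (auto intro: exp_below_mono)
qed auto

lemma ex_com_below: "\<exists>m. com_below m c"
proof (induction c)
  case (Assign x e)
  obtain m where "exp_below m e" using ex_exp_below by blast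
  then show ?case by (intro exI[of _ "max m (Suc x)"]) (auto intro: exp_below_mono)
next
  case (Seq c d)
  then obtain m n where "com_below m c" "com_below n d" by blast
  then show ?case by (intro exI[of _ "max m n"]) (auto intro: com_below_mono)
next
  case (If e c d)
  then obtain m n where "com_below m c" "com_below n d" by blast
  moreover obtain k where "exp_below k e" using ex_exp_below by blast
  ultimately show ?case
    by (intro exI[of _ "max k (max m n)"]) (auto intro: com_below_mono exp_below_mono)
next
  case (While e c)
  then obtain m where "com_below m c" by blast
  moreover obtain k where "exp_below k e" using ex_exp_below by blast
  ultimately show ?case
    by (intro exI[of _ "max k m"]) (auto intro: com_below_mono exp_below_mono)
qed auto

lemma exp_below_eval: "exp_below m e \<Longrightarrow> (\<And>i. i < m \<Longrightarrow> u i = s i) \<Longrightarrow> eval_exp e u = eval_exp e s \<and> cost e u = cost e s"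
  by (induction e) auto

text \<open>A program confined to variables below \<open>m\<close> cannot notice what
  \<open>u\<close> puts above, and takes the same time.\<close>

definition overlay :: "nat \<Rightarrow> store \<Rightarrow> store \<Rightarrow> store" where
  "overlay m s u = (\<lambda>i. if i < m then s i else u i)"

lemma exec_overlay: "exec c s t s' \<Longrightarrow> com_below m c \<Longrightarrow> exec c (overlay m s u) t (overlay m s' u)"
proof (induction rule: exec.induct)
  case (exec_Skip s)
  show ?case by (rule exec.exec_Skip)
next
  case (exec_Assign x e s)
  then have e: "eval_exp e (overlay m s u) = eval_exp e s" "cost e (overlay m s u) = cost e s"
    using exp_below_eval[of m e "overlay m s u" s] by (simp_all add: overlay_def)
  have "overlay m (s(x := eval_exp e s)) u = (overlay m s u)(x := eval_exp e (overlay m s u))"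
    using exec_Assign by (auto simp: e fun_eq_iff) (auto simp: overlay_def)
  then show ?case using exec.exec_Assign[of x e "overlay m s u"] by (simp only: e)
next
  case (exec_IfTrue e s c t s' d)
  then have "eval_exp e (overlay m s u) = eval_exp e s" "cost e (overlay m s u) = cost e s"
    using exp_below_eval[of m e "overlay m s u" s] by (simp_all add: overlay_def)
  then show ?case using exec_IfTrue exec.exec_IfTrue by (metis com_below.simps(4))
next
  case (exec_IfFalse e s d t s' c)
  then have "eval_exp e (overlay m s u) = eval_exp e s" "cost e (overlay m s u) = cost e s"
    using exp_below_eval[of m e "overlay m s u" s] by (simp_all add: overlay_def)
  then show ?case using exec_IfFalse exec.exec_IfFalse by (metis com_below.simps(4))
next
  case (exec_WhileFalse e s c)
  then have "eval_exp e (overlay m s u) = eval_exp e s" "cost e (overlay m s u) = cost e s"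
    using exp_below_eval[of m e "overlay m s u" s] by (simp_all add: overlay_def)
  then show ?case using exec_WhileFalse exec.exec_WhileFalse by metis
next
  case (exec_WhileTrue e s c t s' t' s'')
  then have "eval_exp e (overlay m s u) = eval_exp e s" "cost e (overlay m s u) = cost e s"
    using exp_below_eval[of m e "overlay m s u" s] by (simp_all add: overlay_def)
  then show ?case using exec_WhileTrue exec.exec_WhileTrue by (metis com_below.simps(5))
qed (auto intro: exec.intros)

text \<open>An assignment is charged at least the size of the value it stores. This yields the size
  clause of \<open>implements\<close> for a program of which only the running time is known.\<close>

lemma exec_size: "exec c s t s' \<Longrightarrow> size (s' x) \<le> size (s x) + t"
proof (induction rule: exec.induct)
  case (exec_Assign y e s)
  then show ?case using size_eval_exp_le[of e s] by simp
qed auto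

fun clear_vars :: "nat \<Rightarrow> com" where
  "clear_vars 0 = Skip"
| "clear_vars (Suc n) = Seq (clear_vars n) (Assign (Suc n) LeafE)"

lemma runs_clear_vars: "runs (clear_vars n) s (\<lambda>i. if 0 < i \<and> i \<le> n then Leaf else s i) (2 * n + 1)"
proof (induction n)
  case 0
  have "(\<lambda>i. if 0 < i \<and> i \<le> 0 then Leaf else s i) = s" by auto
  then show ?case using exec_Skip unfolding runs_def by auto
next
  case (Suc n)
  let ?s = "\<lambda>n i. if 0 < i \<and> i \<le> n then Leaf else s i"
  have "runs (Assign (Suc n) LeafE) (?s n) (?s (Suc n)) 2"
    by (rule runs_Assign) (auto simp: fun_eq_iff)
  from runs_Seq[OF Suc this] show ?case by simp
qed

text \<open>The given program is specified on an otherwise empty store and may leave garbage. It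
  mentions finitely many variables, so it runs alike in every store whose first \<open>m\<close>
  variables look initial, and \<open>clear_vars\<close> removes what it leaves. Nothing is assumed
  on input 0, hence the test before the call.\<close>

lemma ptime_of_computes:
  fixes f :: "nat \<Rightarrow> 'b::enc list"
  assumes c: "\<And>n. n \<ge> 1 \<Longrightarrow> \<exists>t\<le>poly p n. computes c (enc n) (enc (f n)) t"
  shows "ptime (\<lambda>n. if n = 0 then [] else f n)"
proof -
  obtain m0 where "com_below m0 c" using ex_com_below by blast
  \<comment> \<open>\<open>Suc\<close> keeps the input and output variable \<open>0\<close> inside
    the overlaid part even if the program mentions no variable.\<close>
  then have below: "com_below (Suc m0) c" by (rule com_below_mono) simp
  define m where "m = Suc m0"
  let ?f = "\<lambda>n. if n = 0 then [] else f n"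
  let ?p = "[:2 * m + 4, 2:] + p"
  define prog where "prog = If (Var 0) (Seq c (clear_vars m)) Skip"
  have "implements prog (Suc m) ?p ?f"
    unfolding implements_def
  proof (intro allI impI)
    fix n :: nat and s :: store
    assume s: "s 0 = enc n \<and> (\<forall>i. 0 < i \<and> i < Suc m \<longrightarrow> s i = Leaf)"
    show "size (enc (?f n)) \<le> poly ?p (size (enc n)) \<and> runs prog s (s(0 := enc (?f n))) (poly ?p (size (enc n)))"
    proof (cases "n = 0")
      case True
      have "runs prog s s (1 + cost (Var 0) s + 1)" unfolding prog_def
      proof (rule runs_If[OF _ _ order_refl])
        show "runs Skip s s 1" using exec_Skip by (auto simp: runs_def)
      qed (use s True in simp)
      then have "runs prog s s (poly ?p 0)" by (rule runs_mono) (use s True in simp)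
      \<comment> \<open>The encodings of 0 and of the empty list are both \<open>Leaf\<close>, so
        skipping already leaves the right output.\<close>
      moreover have "s(0 := Leaf) = s" using s True by (simp add: fun_upd_idem)
      ultimately show ?thesis using True by simp
    next
      case False
      then obtain t s' where t: "t \<le> poly p n" "exec c ((\<lambda>_. Leaf)(0 := enc n)) t s'" "s' 0 = enc (f n)"
        using c[of n] unfolding computes_def by auto
      have "overlay m ((\<lambda>_. Leaf)(0 := enc n)) s = s"
        using s by (auto simp: overlay_def fun_eq_iff m_def)
      with exec_overlay[OF t(2) below, of s] have "exec c s t (overlay m s' s)" by (simp add: m_def)
      then have 1: "runs c s (overlay m s' s) (poly p n)" using t(1) by (auto simp: runs_def)
      have "(\<lambda>i. if 0 < i \<and> i \<le> m then Leaf else overlay m s' s i) = s(0 := enc (f n))"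
        using s t(3) by (auto simp: fun_eq_iff overlay_def m_def)
      with runs_clear_vars[of m "overlay m s' s"]
      have 2: "runs (clear_vars m) (overlay m s' s) (s(0 := enc (f n))) (2 * m + 1)" by simp
      have "runs prog s (s(0 := enc (f n))) (1 + cost (Var 0) s + (poly p n + (2 * m + 1)))"
        unfolding prog_def
      proof (rule runs_If[OF _ _ order_refl])
        show "runs (Seq c (clear_vars m)) s (s(0 := enc (f n))) (poly p n + (2 * m + 1))"
          by (rule runs_Seq[OF 1 2]) simp
      next
        assume "eval_exp (Var 0) s = Leaf"
        then show "runs Skip s (s(0 := enc (f n))) (poly p n + (2 * m + 1))" using s False by (cases n) auto
      qed
      then have "runs prog s (s(0 := enc (f n))) (poly ?p n)" by (rule runs_mono) (use s in simp)
      moreover have "size (enc (f n)) \<le> n + poly p n"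
        using exec_size[OF t(2), of 0] t(1,3) by simp
      ultimately show ?thesis using False by simp
    qed
  qed
  then show ?thesis unfolding ptime_def by blast
qed

lemma size_enc_gate: "gate_on N g \<Longrightarrow> size (enc g) \<le> 2 * N + 6"
  by (cases g) (simp_all add: enc_gate_inst flip: enc_nat_inst)

lemma size_enc_circuit: "clifford_circuit N gs \<Longrightarrow> size (enc gs) \<le> length gs * (2 * N + 7)"
  using size_enc_le[of gs "2 * N + 6"] size_enc_gate unfolding clifford_circuit_def
  by (fastforce simp: algebra_simps)

theorem theorem2:
  "\<exists>alg :: com.
     poly_time_on alg {enc_input N gs | N gs. N \<ge> 1 \<and> clifford_circuit N gs} \<and>
     (\<forall>C :: nat \<Rightarrow> gate list. clifford_family C \<and> poly_sized C \<longrightarrow>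
       (\<exists>C' R1 R2 R3 :: nat \<Rightarrow> gate list.
          clifford_family C' \<and> poly_sized C' \<and>
          (uniform_family C \<longrightarrow> uniform_family C') \<and>
          poly_sized R2 \<and> poly_sized R3 \<and>
          (\<forall>N\<ge>1.
             equal_up_to_phase (apply_circuit N (C N) (zero_state N))
               (apply_circuit N (C' N) (zero_state N)) \<and>
             C' N = R1 N @ R2 N @ R3 N \<and>
             hadamard_round N (R1 N) \<and>
             not_cnot_round N (R2 N) \<and>
             phase_cphase_round N (R3 N) \<and>
             (\<exists>t. computes alg (enc_input N (C N)) (enc_rounds (R1 N) (R2 N) (R3 N)) t))))"
proof -
  obtain alg p where alg: "\<And>x. \<exists>t. computes alg (enc x) (enc (rounds (fst x) (snd x))) t \<and> t \<le> poly p (size (enc x))"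
    using ptime_computes[OF ptime_rounds] by blast
  obtain q where q: "\<And>x. size (enc (rounds (fst x) (snd x))) \<le> poly q (size (enc x))"
    using ptime_size[OF ptime_rounds] by blast
  have poly: "poly_time_on alg {enc_input N gs | N gs. N \<ge> 1 \<and> clifford_circuit N gs}"
    unfolding poly_time_on_def
  proof (intro exI[of _ p] ballI)
    fix x assume "x \<in> {enc_input N gs | N gs. N \<ge> 1 \<and> clifford_circuit N gs}"
    then obtain N :: nat and gs :: "gate list" where "x = enc (N, gs)" unfolding enc_input_eq by blast
    with alg[of "(N, gs)"] show "\<exists>y t. computes alg x y t \<and> t \<le> poly p (size x)" by auto
  qed
  have family: "\<exists>C' R1 R2 R3 :: nat \<Rightarrow> gate list.
          clifford_family C' \<and> poly_sized C' \<and>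
          (uniform_family C \<longrightarrow> uniform_family C') \<and>
          poly_sized R2 \<and> poly_sized R3 \<and>
          (\<forall>N\<ge>1.
             equal_up_to_phase (apply_circuit N (C N) (zero_state N))
               (apply_circuit N (C' N) (zero_state N)) \<and>
             C' N = R1 N @ R2 N @ R3 N \<and>
             hadamard_round N (R1 N) \<and>
             not_cnot_round N (R2 N) \<and>
             phase_cphase_round N (R3 N) \<and>
             (\<exists>t. computes alg (enc_input N (C N)) (enc_rounds (R1 N) (R2 N) (R3 N)) t))"
    if "clifford_family C" "poly_sized C" for C
  proof -
    have cc: "clifford_circuit N (C N)" if "N \<ge> 1" for N
      using \<open>clifford_family C\<close> that by (simp add: clifford_family_def)
    \<comment> \<open>A generator of \<open>C\<close> promises nothing at 0; with the value there
      replaced, the family becomes a polynomial-time function on all numbers.\<close>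
    define C1 where "C1 N = (if N = 0 then [] else C N)" for N
    define R1 where "R1 N = fst (rounds N (C1 N))" for N
    define R2 where "R2 N = fst (snd (rounds N (C1 N)))" for N
    define R3 where "R3 N = snd (snd (rounds N (C1 N)))" for N
    define C' where "C' N = R1 N @ R2 N @ R3 N" for N
    have C1: "C1 N = C N" if "N \<ge> 1" for N using that by (simp add: C1_def)
    have R: "rounds N (C N) = (R1 N, R2 N, R3 N)" if "N \<ge> 1" for N
      using C1[OF that] by (simp add: R1_def R2_def R3_def)
    obtain pc where pc: "\<And>N. N \<ge> 1 \<Longrightarrow> length (C N) \<le> poly pc N"
      using \<open>poly_sized C\<close> unfolding poly_sized_def by blast
    \<comment> \<open>The input of the algorithm is a pair of \<open>N\<close>, contributing N + 1
      with the pair node, and a circuit of at most \<open>poly pc N\<close> gates, each contributing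
      at most 2 * N + 7 to the encoding of the list.\<close>
    let ?r = "pcompose q ([:1, 1:] + pc * [:7, 2:])"
    have len: "length (C' N) \<le> poly ?r N" if "N \<ge> 1" for N
    proof -
      have "size (enc (C N)) \<le> length (C N) * (2 * N + 7)" by (rule size_enc_circuit[OF cc[OF that]])
      also have "\<dots> \<le> poly pc N * (2 * N + 7)" using pc[OF that] by (rule mult_right_mono) simp
      finally have "size (enc (N, C N)) \<le> poly ([:1, 1:] + pc * [:7, 2:]) N" by (simp add: algebra_simps)
      then have "poly q (size (enc (N, C N))) \<le> poly ?r N"
        unfolding poly_pcompose by (rule poly_nat_mono)
      moreover have "length (C' N) \<le> size (enc (R1 N, R2 N, R3 N))"
        using length_le_size_enc[of "R1 N"] length_le_size_enc[of "R2 N"] length_le_size_enc[of "R3 N"]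
        by (simp add: C'_def)
      ultimately show ?thesis using q[of "(N, C N)"] R[OF that] by simp
    qed
    have "poly_sized C'" "poly_sized R2" "poly_sized R3"
      unfolding poly_sized_def using len by (force simp: C'_def intro!: exI[of _ ?r])+
    moreover have correct: "hadamard_round N (R1 N)" "not_cnot_round N (R2 N)" "phase_cphase_round N (R3 N)"
      "clifford_circuit N (C' N)"
      "equal_up_to_phase (apply_circuit N (C N) (zero_state N)) (apply_circuit N (C' N) (zero_state N))"
      if "N \<ge> 1" for N
      unfolding C'_def by (rule rounds_correct[OF cc[OF that] R[OF that]])+
    moreover have "clifford_family C'" using correct(4) by (simp add: clifford_family_def)
    moreover have "\<exists>t. computes alg (enc_input N (C N)) (enc_rounds (R1 N) (R2 N) (R3 N)) t" if "N \<ge> 1" for N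
      using alg[of "(N, C N)"] R[OF that] unfolding enc_input_eq enc_rounds_eq by auto
    moreover have "uniform_family C'" if u: "uniform_family C"
    proof -
      obtain c pu where "\<And>N. N \<ge> 1 \<Longrightarrow> \<exists>t\<le>poly pu N. computes c (enc N) (enc (C N)) t"
        using u unfolding uniform_family_def enc_circuit_eq enc_nat_inst[symmetric] by blast
      then have "ptime C1" unfolding C1_def[abs_def] by (rule ptime_of_computes)
      then have rnd: "ptime (\<lambda>N. rounds N (C1 N))" by (intro ptime_comp2[OF ptime_rounds] ptime_id)
      have "ptime C'" unfolding C'_def[abs_def] R1_def R2_def R3_def by (intro ptime_intros rnd)
      then obtain d pd where d: "\<And>N. \<exists>t. computes d (enc N) (enc (C' N)) t \<and> t \<le> poly pd N"
        using ptime_computes[of C'] unfolding size_enc_nat by blast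
      show ?thesis
        unfolding uniform_family_def enc_circuit_eq enc_nat_inst[symmetric]
        by (intro exI[of _ d] exI[of _ pd]) (use d in blast)
    qed
    ultimately show ?thesis
      by (intro exI[of _ C'] exI[of _ R1] exI[of _ R2] exI[of _ R3]) (simp add: C'_def)
  qed
  show ?thesis using poly family by blast
qed

end
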